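(* Let $p=(p_x)_{x\in\mathbb{Z}}$ be an environment, i.e. $p_x\in[c,1]$ for all $x$ with $c=\inf_xp_x>0$, such that $$p_x>c\ \text{ for all }x\in\mathbb{Z}\quad\text{and}\quad\liminf_{x\to-\infty}p_x=c,$$ and let $\nu$ be an arbitrary probability measure on $\mathbb{N}^{\mathbb{Z}}$. Then the set of measures $\{\nu S_p(t):t>0\}$ is tight, and every weak limit $\tilde\nu$ of $\nu S_p(t)$ as $t$ goes to infinity (i.e. every weak limit along a sequence of times tending to infinity) satisfies $\tilde\nu\le\nu_{p,c}$.
   Context: Notation: $\mathbb{N}=\{0,1,2,\dots\}$ and $\mathbf{X}=\mathbb{N}^{\mathbb{Z}}$ with the product topology. Process: given the environment $p$, let $(N_x(t))_{x\in\mathbb{Z}}$ be independent Poisson processes with $\mathbf{E}(N_x(t))=p_xt$, independent of the initial configuration. The totally asymmetric zero-range process $(\eta_t)_{t\ge0}$ on $\mathbf{X}$ with rates $p$ evolves as follows: if $N_x(\cdot)$ jumps at time $t$ and $\eta_{t-}(x)>0$, then one particle is moved from $x$ to $x+1$ at time $t$; if $\eta_{t-}(x)=0$ nothing happens. The process is well defined from every initial configuration, because for every $t$ and $x$ there is almost surely some $y<x$ with $N_y(t)=0$, so that $\eta_t(x)$ depends only on the initial configuration and finitely many jumps. Its generator acts on cylinder functions by $$(L_pf)(\eta)=\sum_{x\in\mathbb{Z}}p_x\mathbf{1}\{\eta(x)>0\}[f(\eta^x)-f(\eta)],\qquad \eta^x=\eta-\mathfrak{d}_x+\mathfrak{d}_{x+1},$$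 where $\mathfrak{d}_y$ is the configuration with a single particle, at $y$. Its semigroup is $S_p(t)f(\eta)=\mathbf{E}[f(\eta_t)\mid\eta_0=\eta]$, and $\nu S_p(t)$ denotes the law at time $t$ when the initial law is $\nu$. $\nu_{p,c}$ is the product probability measure on $\mathbf{X}$ with marginals $\nu_{p,c}\{\xi:\xi(x)=k\}=(c/p_x)^k(1-c/p_x)$, $k\in\mathbb{N}$ (well defined since $p_x>c$ for all $x$). Order: $\eta\le\xi$ in $\mathbf{X}$ means $\eta(x)\le\xi(x)$ for all $x$; a function $f:\mathbf{X}\to\mathbb{R}$ is increasing if $\eta\le\xi$ implies $f(\eta)\le f(\xi)$; for probability measures, $\mu\le\nu$ means $\int f\,d\mu\le\int f\,d\nu$ for all bounded increasing cylinder functions $f$ (functions depending on finitely many coordinates). *)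

theory Defs
  imports "HOL-Probability.Probability"
begin

text \<open>
  Configurations are functions \<open>int \<Rightarrow> nat\<close>. The instances of HOL-Analysis give this type the product
  of the discrete topologies and the pointwise order; \<open>borel\<close> is also the product sigma-algebra,
  as the index set is countable.
\<close>

type_synonym config = "int \<Rightarrow> nat"

definition environment :: "(int \<Rightarrow> real) \<Rightarrow> real \<Rightarrow> bool" where
  "environment p c \<longleftrightarrow> (\<forall>x. p x \<in> {c..1}) \<and> c = (INF x. p x) \<and> c > 0"


subsection \<open>Poisson processes\<close>

text \<open>Time is \<open>[0, \<infinity>)\<close>; values at negative times are irrelevant. Since paths are almost surely
  nondecreasing, the truncated differences below are almost surely genuine increments.\<close>

definition (in prob_space) poisson_process :: "real \<Rightarrow> (real \<Rightarrow> 'a \<Rightarrow> nat) \<Rightarrow> bool" where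
  "poisson_process r N \<longleftrightarrow>
     (\<forall>t\<ge>0. random_variable (count_space UNIV) (N t)) \<and>
     (AE \<omega> in M. N 0 \<omega> = 0 \<and> mono_on {0..} (\<lambda>t. N t \<omega>) \<and>
                 (\<forall>t\<ge>0. continuous (at_right t) (\<lambda>s. N s \<omega>))) \<and>
     (\<forall>s t. 0 \<le> s \<longrightarrow> s < t \<longrightarrow>
        distr M (count_space UNIV) (\<lambda>\<omega>. N t \<omega> - N s \<omega>) = measure_pmf (poisson_pmf (r * (t - s)))) \<and>
     (\<forall>n (\<tau> :: nat \<Rightarrow> real). 0 \<le> \<tau> 0 \<longrightarrow> strict_mono \<tau> \<longrightarrow>
        indep_vars (\<lambda>_. count_space UNIV) (\<lambda>i \<omega>. N (\<tau> (Suc i)) \<omega> - N (\<tau> i) \<omega>) {..<n})"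

definition jumps_at :: "(real \<Rightarrow> nat) \<Rightarrow> real \<Rightarrow> bool" where
  "jumps_at n t \<longleftrightarrow> \<not> continuous (at_left t) n"


subsection \<open>The totally asymmetric zero-range process\<close>

definition move :: "int \<Rightarrow> config \<Rightarrow> config" where
  "move x \<eta> = \<eta>(x := \<eta> x - 1, x + 1 := \<eta> (x + 1) + 1)"

text \<open>The configuration \<open>\<xi>\<close> below is the left limit of the path at time \<open>t\<close>. Almost surely no two of
  the Poisson processes jump simultaneously, so the prescription is consistent.\<close>

definition zero_range_path :: "(int \<Rightarrow> real \<Rightarrow> nat) \<Rightarrow> (real \<Rightarrow> config) \<Rightarrow> bool" where
  "zero_range_path n \<eta> \<longleftrightarrow>
     (\<forall>t\<ge>0. continuous (at_right t) \<eta>) \<and>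
     (\<forall>t>0. \<exists>\<xi>. (\<eta> \<longlongrightarrow> \<xi>) (at_left t) \<and>
        (\<forall>x. jumps_at (n x) t \<and> \<xi> x > 0 \<longrightarrow> \<eta> t = move x \<xi>) \<and>
        ((\<forall>x. \<not> (jumps_at (n x) t \<and> \<xi> x > 0)) \<longrightarrow> \<eta> t = \<xi>))"

text \<open>The joint independence of the initial configuration (index \<open>None\<close>) and of the processes
  \<open>N x\<close> (index \<open>Some x\<close>) is expressed through the sigma-algebras they generate.\<close>

locale zero_range_process = prob_space M
  for M :: "'a measure"
  and p :: "int \<Rightarrow> real"
  and N :: "int \<Rightarrow> real \<Rightarrow> 'a \<Rightarrow> nat"
  and \<eta> :: "real \<Rightarrow> 'a \<Rightarrow> config" +
  assumes poisson: "\<And>x. poisson_process (p x) (N x)"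
    and indep: "indep_sets (case_option
          (sets (vimage_algebra (space M) (\<eta> 0) borel))
          (\<lambda>x. sets (vimage_algebra (space M) (\<lambda>\<omega>. \<lambda>t\<in>{0..}. N x t \<omega>)
                                     (\<Pi>\<^sub>M t\<in>{0..}. count_space UNIV)))) UNIV"
    and measurable: "\<And>t. t \<ge> 0 \<Longrightarrow> random_variable borel (\<eta> t)"
    and dynamics: "AE \<omega> in M. zero_range_path (\<lambda>x t. N x t \<omega>) (\<lambda>t. \<eta> t \<omega>)"


subsection \<open>Product measures, tightness, weak convergence, stochastic order\<close>

definition nu_prod :: "(int \<Rightarrow> real) \<Rightarrow> real \<Rightarrow> config measure" where
  "nu_prod p c = (\<Pi>\<^sub>M x\<in>UNIV. measure_pmf (geometric_pmf (1 - c / p x)))"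

lemma measure_nu_prod_marginal:
  assumes "0 < c" "c < p x"
  shows "measure (nu_prod p c) {\<xi>. \<xi> x = k} = (c / p x) ^ k * (1 - c / p x)"
proof -
  interpret product_prob_space "\<lambda>x. measure_pmf (geometric_pmf (1 - c / p x))" UNIV
    by unfold_locales
  have emb: "{\<xi>. \<xi> x = k} = emb UNIV {x} (Pi\<^sub>E {x} (\<lambda>_. {k}))"
    by (auto simp: prod_emb_def space_PiM PiE_def extensional_def restrict_def
        intro!: ext dest: fun_cong[where x = x])
  have "measure (nu_prod p c) {\<xi>. \<xi> x = k} = measure (measure_pmf (geometric_pmf (1 - c / p x))) {k}"
    unfolding nu_prod_def emb by (subst measure_PiM_emb) auto
  also have "\<dots> = (c / p x) ^ k * (1 - c / p x)"
    using assms by (simp add: measure_pmf_single)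
  finally show ?thesis .
qed

lemma sets_nu_prod: "sets (nu_prod p c) = sets borel"
proof -
  have "sets (nu_prod p c) = sets (\<Pi>\<^sub>M x\<in>(UNIV :: int set). (borel :: nat measure))"
    unfolding nu_prod_def by (intro sets_PiM_cong) (auto simp: sets_borel_eq_count_space)
  thus ?thesis
    by (simp add: sets_PiM_equal_borel)
qed

text \<open>HOL-Probability has tightness and weak convergence only for measures on the real line.\<close>

definition tight_family :: "'b::topological_space measure set \<Rightarrow> bool" where
  "tight_family A \<longleftrightarrow> (\<forall>\<epsilon>>0. \<exists>K. compact K \<and> (\<forall>\<mu>\<in>A. measure \<mu> (space \<mu> - K) < \<epsilon>))"

definition weakly_converges ::
    "(nat \<Rightarrow> 'b::topological_space measure) \<Rightarrow> 'b measure \<Rightarrow> bool" where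
  "weakly_converges \<mu> \<nu> \<longleftrightarrow>
     (\<forall>f :: 'b \<Rightarrow> real. continuous_on UNIV f \<longrightarrow> bounded (range f) \<longrightarrow>
        (\<lambda>n. \<integral>\<eta>. f \<eta> \<partial>\<mu> n) \<longlonglongrightarrow> (\<integral>\<eta>. f \<eta> \<partial>\<nu>))"

definition cylinder :: "(config \<Rightarrow> real) \<Rightarrow> bool" where
  "cylinder f \<longleftrightarrow> (\<exists>J. finite J \<and> (\<forall>\<eta> \<xi>. (\<forall>x\<in>J. \<eta> x = \<xi> x) \<longrightarrow> f \<eta> = f \<xi>))"

definition stoch_le :: "config measure \<Rightarrow> config measure \<Rightarrow> bool" where
  "stoch_le \<mu> \<nu> \<longleftrightarrow>
     (\<forall>f. bounded (range f) \<longrightarrow> mono f \<longrightarrow> cylinder f \<longrightarrow> (\<integral>\<eta>. f \<eta> \<partial>\<mu>) \<le> (\<integral>\<eta>. f \<eta> \<partial>\<nu>))"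

end

theory Submission
  imports Defs "HOL-Real_Asymp.Real_Asymp"
begin

text \<open>
  Fix a window of sites and a site \<open>y\<close> to its left that is slower than every site in \<open>{y<..m}\<close>.
  Since \<open>p\<close> stays above \<open>c\<close> but comes arbitrarily close to \<open>c\<close> on the left, such sites exist
  arbitrarily far to the left, with \<open>p y\<close> arbitrarily close to \<open>c\<close> (\<open>slow_record_site\<close>). If \<open>y\<close> is
  given an inexhaustible supply of particles, the process on \<open>{y<..m}\<close> can only grow, and it no
  longer depends on what happens outside the window: it is a tandem of queues with Poisson input of
  rate \<open>p y\<close> and service rates \<open>p z > p y\<close>. Such a tandem has the product of the geometric laws with
  parameters \<open>p y / p z\<close> as an invariant law (\<open>equilibrium_invariant\<close>), and it converges to this law
  from every initial state. As \<open>y\<close> moves to the left, these laws converge to the marginals of the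
  maximal product measure with parameter \<open>c\<close>.

  Convergence comes from a coupling. A tandem in equilibrium and a second one started
  with additional particles, both driven by the same clocks, stay ordered, and the number of
  surplus particles never grows. Hence the larger tandem remains tight, and in each block of time
  it has a probability bounded below to become empty, which makes the two coincide
  (\<open>discrepancy_step\<close>, \<open>discrepancy_vanishes\<close>). The same comparison bounds the mass of the larger
  tandem uniformly in time (\<open>ring_iter_heavy_le\<close>), which gives tightness.

  No continuous-time construction of the tandem is needed. Time up to \<open>t\<close> is cut into \<open>n\<close> cells;
  except on an event of probability \<open>O(1 / n)\<close>, no cell contains two rings of the clocks in the
  window, and then the zero-range path is dominated by a discrete-time chain that moves a particle
  in each cell with a ring (\<open>dominated_by_envelope\<close>). This chain is a lazy version of the chain that
  rings one clock per step, so convergence of the latter carries over uniformly in \<open>n\<close>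
  (\<open>lazy_iterate_le\<close>). The chain starts from a deterministic state that dominates the initial configuration in
  the window with probability close to one.
\<close>


section \<open>Averages over random updates\<close>

definition average :: "'v set \<Rightarrow> ('v \<Rightarrow> real) \<Rightarrow> ('v \<Rightarrow> 's \<Rightarrow> 's) \<Rightarrow> ('s \<Rightarrow> real) \<Rightarrow> 's \<Rightarrow> real" where
  "average V w h F x = (\<Sum>v\<in>V. w v * F (h v x))"

definition lazy_average :: "'v set \<Rightarrow> ('v \<Rightarrow> real) \<Rightarrow> ('v \<Rightarrow> 's \<Rightarrow> 's) \<Rightarrow> real \<Rightarrow> ('s \<Rightarrow> real) \<Rightarrow> 's \<Rightarrow> real" where
  "lazy_average V w h \<theta> G x = (1 - \<theta>) * G x + \<theta> * average V w h G x"

locale random_updates =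
  fixes V :: "'v set" and w :: "'v \<Rightarrow> real"
  assumes finite_updates: "finite V"
    and weight_pos: "\<And>v. v \<in> V \<Longrightarrow> 0 < w v"
    and weight_sum: "sum w V = 1"
begin

lemma average_mono:
  assumes "\<And>v. v \<in> V \<Longrightarrow> F (h v x) \<le> G (h v x)"
  shows "average V w h F x \<le> average V w h G x"
  unfolding average_def by (intro sum_mono mult_left_mono assms less_imp_le weight_pos)

lemma average_linear:
  "average V w h (\<lambda>x. a * F x + b * G x) x = a * average V w h F x + b * average V w h G x"
  by (simp add: average_def sum.distrib sum_distrib_left algebra_simps)

lemma average_iter_mono:
  assumes closed: "\<And>v x. v \<in> V \<Longrightarrow> x \<in> S \<Longrightarrow> h v x \<in> S"
    and le: "\<And>x. x \<in> S \<Longrightarrow> F x \<le> G x"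
    and "x \<in> S"
  shows "(average V w h ^^ j) F x \<le> (average V w h ^^ j) G x"
  using \<open>x \<in> S\<close> by (induction j arbitrary: x) (auto intro!: average_mono simp: le closed)

lemma average_iter_linear:
  "(average V w h ^^ j) (\<lambda>x. a * F x + b * G x) x =
     a * (average V w h ^^ j) F x + b * (average V w h ^^ j) G x"
proof (induction j arbitrary: x)
  case (Suc j)
  show ?case by (simp add: Suc[abs_def] average_linear)
qed simp

lemma average_iter_const: "(average V w h ^^ j) (\<lambda>_. a) x = a"
  by (induction j arbitrary: x) (simp_all add: average_def weight_sum flip: sum_distrib_right)

lemma average_iter_factor:
  assumes "\<And>v x. v \<in> V \<Longrightarrow> \<phi> (h v x) = h' v (\<phi> x)"
  shows "(average V w h ^^ j) (\<lambda>x. F (\<phi> x)) x = (average V w h' ^^ j) F (\<phi> x)"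
  by (induction j arbitrary: x) (simp_all add: average_def assms)

lemma average_iter_bounds:
  assumes "\<And>x. 0 \<le> F x" "\<And>x. F x \<le> B"
  shows "0 \<le> (average V w h ^^ j) F x" "(average V w h ^^ j) F x \<le> B"
  using average_iter_mono[of UNIV h "\<lambda>_. 0" F x j] average_iter_mono[of UNIV h F "\<lambda>_. B" x j] assms
  by (simp_all add: average_iter_const)

text \<open>The lazy iterate mixes the values \<open>(average ^^ j) F x\<close> over a binomially distributed \<open>j\<close>, and the
  exceptional times \<open>j < J\<close> have small weight once \<open>n * \<theta>\<close> is large. Bounding the indicator of
  \<open>j < J\<close> by the exponential \<open>2 ^ J / 2 ^ j\<close> makes this a one-line recursion, since one update halves
  the exponential and a lazy step therefore multiplies it by \<open>1 - \<theta> / 2\<close>.\<close>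
lemma lazy_iterate_le:
  fixes \<theta> b A :: real
  assumes "0 \<le> \<theta>" "\<theta> \<le> 1" "0 \<le> A"
    and early: "\<And>j. (average V w h ^^ j) F x \<le> b + A"
    and late: "\<And>j. j \<ge> J \<Longrightarrow> (average V w h ^^ j) F x \<le> b"
  shows "(lazy_average V w h \<theta> ^^ n) F x \<le> b + A * 2 ^ J * (1 - \<theta> / 2) ^ n"
proof -
  let ?R = "average V w h"
  let ?Q = "\<lambda>G x. (1 - \<theta>) * G x + \<theta> * ?R G x"
  have Q: "lazy_average V w h \<theta> = ?Q"
    by (simp add: fun_eq_iff lazy_average_def)
  have comm: "?R (?Q G) = ?Q (?R G)" for G
    by (rule ext) (rule average_linear)
  have comm_iter: "?Q ((?R ^^ j) G) = (?R ^^ j) (?Q G)" for j G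
    by (induction j) (simp_all add: comm[symmetric])
  have "(?R ^^ j) ((?Q ^^ n) F) x \<le> b + A * (2 ^ J / 2 ^ j) * (1 - \<theta> / 2) ^ n" for j
  proof (induction n arbitrary: j)
    case 0
    show ?case
    proof (cases "j \<ge> J")
      case True
      then show ?thesis using late[of j] \<open>0 \<le> A\<close> by (simp add: add_increasing2)
    next
      case False
      then have "1 \<le> (2 ^ J / 2 ^ j :: real)" by (simp add: divide_simps)
      then have "A * 1 \<le> A * (2 ^ J / 2 ^ j)" using \<open>0 \<le> A\<close> by (intro mult_left_mono) auto
      then show ?thesis using early[of j] by simp
    qed
  next
    case (Suc n)
    let ?q = "A * (2 ^ J / 2 ^ j) * (1 - \<theta> / 2) ^ n"
    have "(?R ^^ j) ((?Q ^^ Suc n) F) x = ?Q ((?R ^^ j) ((?Q ^^ n) F)) x"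
      by (simp add: comm_iter[symmetric])
    also have "\<dots> = (1 - \<theta>) * (?R ^^ j) ((?Q ^^ n) F) x + \<theta> * (?R ^^ Suc j) ((?Q ^^ n) F) x"
      by simp
    also have "\<dots> \<le> (1 - \<theta>) * (b + ?q) + \<theta> * (b + ?q / 2)"
      using Suc[of j] Suc[of "Suc j"] assms(1,2)
      by (intro add_mono mult_left_mono) (simp_all add: field_simps)
    also have "\<dots> = b + ?q * (1 - \<theta> / 2)"
      by argo
    also have "\<dots> = b + A * (2 ^ J / 2 ^ j) * (1 - \<theta> / 2) ^ Suc n"
      by simp
    finally show ?case .
  qed
  from this[of 0] show ?thesis unfolding Q by simp
qed

end


section \<open>Queues in tandem\<close>

definition deposit :: "int set \<Rightarrow> int \<Rightarrow> config \<Rightarrow> config" where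
  "deposit W z x = (if z \<in> W then x(z := Suc (x z)) else x)"

text \<open>The sites outside \<open>W\<close> have an infinite supply of particles, and particles that leave \<open>W\<close> are
  forgotten.\<close>
definition hop :: "int set \<Rightarrow> int \<Rightarrow> config \<Rightarrow> config" where
  "hop W v x = (if v \<notin> W then deposit W (v + 1) x
     else if x v = 0 then x else deposit W (v + 1) (x(v := x v - 1)))"

definition mass :: "int set \<Rightarrow> config \<Rightarrow> nat" where
  "mass W x = (\<Sum>z\<in>W. x z)"

lemma mono_deposit: "x \<le> x' \<Longrightarrow> deposit W z x \<le> deposit W z x'"
  by (simp add: deposit_def le_fun_def)

lemma le_deposit: "x \<le> deposit W z x"
  by (simp add: deposit_def le_fun_def)

lemma mono_hop:
  assumes "x \<le> x'"
  shows "hop W v x \<le> hop W v x'"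
proof -
  have le: "x u \<le> x' u" for u using assms by (simp add: le_fun_def)
  consider "v \<notin> W" | "v \<in> W" "x v = 0" "x' v = 0" | "v \<in> W" "x v = 0" "0 < x' v" | "v \<in> W" "0 < x v" "0 < x' v"
    using le[of v] by fastforce
  then show ?thesis
  proof cases
    case 3
    have "x \<le> x'(v := x' v - 1)" using le 3 by (auto simp: le_fun_def)
    also have "\<dots> \<le> deposit W (v + 1) (x'(v := x' v - 1))" by (rule le_deposit)
    finally show ?thesis using 3 by (simp add: hop_def)
  next
    case 4
    have "x(v := x v - 1) \<le> x'(v := x' v - 1)" using le by (auto simp: le_fun_def intro: diff_le_mono)
    then show ?thesis using 4 by (simp add: hop_def mono_deposit)
  qed (use assms in \<open>simp_all add: hop_def mono_deposit\<close>)
qed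

lemma mass_upd:
  assumes "finite W" "z \<in> W"
  shows "mass W (x(z := k)) + x z = mass W x + k"
proof -
  have "mass W x = x z + (\<Sum>u\<in>W - {z}. x u)" for x
    unfolding mass_def using assms by (simp add: sum.remove)
  then show ?thesis by simp
qed

lemma mass_mono: "x \<le> x' \<Longrightarrow> mass W x \<le> mass W x'"
  unfolding mass_def by (intro sum_mono) (simp add: le_fun_def)

lemma mass_deposit:
  assumes "finite W"
  shows "mass W (deposit W z x) = mass W x + of_bool (z \<in> W)"
  using mass_upd[OF assms, of z x "Suc (x z)"] by (auto simp: deposit_def)

lemma mass_hop:
  assumes "finite W"
  shows "mass W (hop W v x) + of_bool (v \<in> W \<and> 0 < x v) =
     mass W x + of_bool (v + 1 \<in> W \<and> (v \<in> W \<longrightarrow> 0 < x v))"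
  using mass_upd[OF assms, of v x "x v - 1"]
  by (auto simp: hop_def mass_deposit[OF assms])

text \<open>A surplus particle is created nowhere: a source feeds both configurations, and a busy site of the
  smaller configuration is busy in the larger one.\<close>
lemma mass_excess_hop:
  assumes "finite W" "z \<le> x"
  shows "mass W (hop W v x) + mass W z \<le> mass W x + mass W (hop W v z)"
proof -
  have "z v \<le> x v" using assms by (simp add: le_fun_def)
  then show ?thesis
    using mass_hop[OF assms(1), of v x] mass_hop[OF assms(1), of v z]
    by (cases "v \<in> W"; cases "v + 1 \<in> W"; cases "x v = 0"; cases "z v = 0") auto
qed

lemma hop_outside: "u \<notin> W \<Longrightarrow> hop W v x u = x u"
  by (auto simp: hop_def deposit_def)


section \<open>The geometric product law of a tandem of queues\<close>

text \<open>A geometric variable conditioned to be positive is one plus a geometric variable.\<close>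
lemma geometric_shift:
  assumes "0 < q" "q < 1"
  shows "(\<integral>\<^sup>+k. (if k = 0 then 0 else h (k - 1)) \<partial>geometric_pmf q) =
    ennreal (1 - q) * (\<integral>\<^sup>+k. h k \<partial>geometric_pmf q)"
  using assms by (subst geometric_bind_pmf_unfold) (simp_all add: nn_integral_bernoulli_pmf mult.commute)

text \<open>On the event that site \<open>z\<close> is occupied, removing one of its particles turns the law into
  \<open>1 - q z\<close> times itself. This is what makes departures balance arrivals below.\<close>
lemma Pi_geometric_shift:
  assumes "finite W" "z \<in> W" "0 < q z" "q z < 1"
  shows "(\<integral>\<^sup>+x. (if x z = 0 then 0 else h (x(z := x z - 1))) \<partial>Pi_pmf W 0 (\<lambda>z. geometric_pmf (q z))) =
    ennreal (1 - q z) * (\<integral>\<^sup>+x. h x \<partial>Pi_pmf W 0 (\<lambda>z. geometric_pmf (q z)))"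
    (is "?L W = _ * ?R W")
proof -
  let ?G = "\<lambda>W. Pi_pmf W 0 (\<lambda>z. geometric_pmf (q z))"
  define W' where "W' = W - {z}"
  have W: "W = insert z W'" "finite W'" "z \<notin> W'" using assms by (auto simp: W'_def)
  have split: "(\<integral>\<^sup>+x. H x \<partial>?G W) = (\<integral>\<^sup>+x. (\<integral>\<^sup>+k. H (x(z := k)) \<partial>geometric_pmf (q z)) \<partial>?G W')" for H
  proof -
    have "?G W = ?G W' \<bind> (\<lambda>x. geometric_pmf (q z) \<bind> (\<lambda>k. return_pmf (x(z := k))))"
      unfolding W(1) by (subst Pi_pmf_insert'[OF W(2,3)], subst bind_commute_pmf) simp
    then show ?thesis by simp
  qed
  have "?L W = (\<integral>\<^sup>+x. (\<integral>\<^sup>+k. (if k = 0 then 0 else h (x(z := k - 1))) \<partial>geometric_pmf (q z)) \<partial>?G W')"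
    by (subst split) (simp cong: if_cong)
  also have "\<dots> = (\<integral>\<^sup>+x. ennreal (1 - q z) * (\<integral>\<^sup>+k. h (x(z := k)) \<partial>geometric_pmf (q z)) \<partial>?G W')"
    using geometric_shift[OF assms(3,4), of "\<lambda>k. h (_(z := k))"] by simp
  also have "\<dots> = ennreal (1 - q z) * ?R W"
    by (subst nn_integral_cmult) (simp_all add: split)
  finally show ?thesis .
qed


text \<open>The site \<open>y\<close> is the source. It is slower than all servers in \<open>{y<..m}\<close>, which makes every queue
  stable.\<close>
locale tandem_queue =
  fixes y m :: int and p :: "int \<Rightarrow> real"
  assumes nonempty: "y < m"
    and source_pos: "0 < p y"
    and source_slowest: "\<And>z. z \<in> {y<..m} \<Longrightarrow> p y < p z"
begin

abbreviation "W \<equiv> {y<..m}"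
abbreviation "E \<equiv> {y..m}"

definition total_rate :: real where "total_rate = (\<Sum>v\<in>E. p v)"

definition equilibrium :: "config pmf" where
  "equilibrium = Pi_pmf W 0 (\<lambda>z. geometric_pmf (1 - p y / p z))"

abbreviation "ring \<equiv> average E (\<lambda>v. p v / total_rate) (hop W)"

lemma rate_pos: "v \<in> E \<Longrightarrow> 0 < p v"
  using source_pos source_slowest[of v] by (cases "v = y") auto

lemma total_rate_pos: "0 < total_rate"
  unfolding total_rate_def using nonempty by (intro sum_pos rate_pos) auto

sublocale random_updates E "\<lambda>v. p v / total_rate"
  by standard (use rate_pos total_rate_pos in \<open>auto simp: total_rate_def simp flip: sum_divide_distrib\<close>)

lemma equilibrium_shift:
  assumes "z \<in> W" "\<And>x. 0 \<le> (f x :: real)"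
  shows "p z * measure_pmf.expectation equilibrium (\<lambda>x. if x z = 0 then 0 else f (x(z := x z - 1))) =
    p y * measure_pmf.expectation equilibrium f"
proof -
  have z: "p y < p z" "0 < p z" using source_slowest[OF assms(1)] source_pos by auto
  let ?g = "\<lambda>x. if x z = 0 then 0 else f (x(z := x z - 1))"
  have "(\<integral>\<^sup>+x. ennreal (?g x) \<partial>equilibrium) = ennreal (p y / p z) * (\<integral>\<^sup>+x. ennreal (f x) \<partial>equilibrium)"
    using Pi_geometric_shift[OF _ assms(1), of "\<lambda>z. 1 - p y / p z" "\<lambda>x. ennreal (f x)"] z source_pos
    by (simp add: equilibrium_def if_distrib[of ennreal] cong: if_cong)
  then have "measure_pmf.expectation equilibrium ?g = (p y / p z) * measure_pmf.expectation equilibrium f"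
    using z source_pos by (simp add: integral_eq_nn_integral assms(2) enn2real_mult)
  then show ?thesis using z by simp
qed

text \<open>In equilibrium each clock \<open>v\<close> acts as if it added a particle at \<open>v + 1\<close> and removed one at \<open>v\<close>, at the
  common rate \<open>p y\<close> (\<open>equilibrium_shift\<close>). The effects of neighbouring clocks cancel in the sum over
  \<open>v\<close>, and adding a particle at either end, outside the window, has no effect.\<close>
lemma equilibrium_invariant:
  assumes "\<And>x. 0 \<le> f x" "\<And>x. f x \<le> (B::real)"
  shows "measure_pmf.expectation equilibrium (ring f) = measure_pmf.expectation equilibrium f"
proof -
  let ?E = "measure_pmf.expectation equilibrium"
  define F where "F z = ?E (\<lambda>x. f (deposit W z x))" for z
  have int: "integrable (measure_pmf equilibrium) g" if "\<And>x. 0 \<le> g x" "\<And>x. g x \<le> B" for g :: "config \<Rightarrow> real"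
    by (rule measure_pmf.integrable_const_bound[where B = B]) (use that in auto)
  have B: "0 \<le> B" using assms[of "\<lambda>_. 0"] by linarith
  have F_out: "F z = ?E f" if "z \<notin> W" for z
    using that by (simp only: F_def deposit_def if_False)
  have balance: "p v * (?E (\<lambda>x. f (hop W v x)) - ?E f) = p y * (F (v + 1) - F v)" if "v \<in> E" for v
  proof (cases "v \<in> W")
    case False
    then have "v = y" using that by auto
    then show ?thesis using F_out[OF False] by (simp add: F_def hop_def)
  next
    case True
    let ?idle = "\<lambda>x. if x v = 0 then f x else 0"
    let ?busy = "\<lambda>g x. if x v = 0 then 0 else g (x(v := x v - 1))"
    have "?E (\<lambda>x. f (hop W v x)) = ?E (\<lambda>x. ?idle x + ?busy (\<lambda>x. f (deposit W (v + 1) x)) x)"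
      using True by (intro Bochner_Integration.integral_cong) (auto simp: hop_def)
    also have "\<dots> = ?E ?idle + ?E (?busy (\<lambda>x. f (deposit W (v + 1) x)))"
      by (intro Bochner_Integration.integral_add int) (use assms B in auto)
    finally have 1: "p v * ?E (\<lambda>x. f (hop W v x)) = p v * ?E ?idle + p y * F (v + 1)"
      using equilibrium_shift[OF True, of "\<lambda>x. f (deposit W (v + 1) x)"] assms
      by (simp add: F_def distrib_left)
    have "?E f = ?E (\<lambda>x. ?idle x + ?busy (\<lambda>x. f (deposit W v x)) x)"
      using True by (intro Bochner_Integration.integral_cong) (auto simp: deposit_def)
    also have "\<dots> = ?E ?idle + ?E (?busy (\<lambda>x. f (deposit W v x)))"
      by (intro Bochner_Integration.integral_add int) (use assms B in auto)
    finally have 2: "p v * ?E f = p v * ?E ?idle + p y * F v"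
      using equilibrium_shift[OF True, of "\<lambda>x. f (deposit W v x)"] assms
      by (simp add: F_def distrib_left)
    show ?thesis using 1 2 by (simp add: right_diff_distrib)
  qed
  have "(\<Sum>v\<in>E. F (v + 1) - F v) = F (m + 1) - F y"
  proof -
    have "(\<Sum>v\<in>{y..y + int n}. F (v + 1) - F v) = F (y + int n + 1) - F y" for n
    proof (induction n)
      case (Suc n)
      have "{y..y + int (Suc n)} = insert (y + int n + 1) {y..y + int n}" by auto
      then show ?case using Suc by (simp add: algebra_simps)
    qed simp
    from this[of "nat (m - y)"] show ?thesis using nonempty by simp
  qed
  also have "\<dots> = 0" by (simp add: F_out)
  finally have telescope: "(\<Sum>v\<in>E. F (v + 1) - F v) = 0" .
  have "?E (ring f) = (\<Sum>v\<in>E. (p v / total_rate) * ?E (\<lambda>x. f (hop W v x)))"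
    unfolding average_def
    by (subst Bochner_Integration.integral_sum)
      (auto intro!: integrable_divide_zero integrable_mult_right int assms)
  also have "\<dots> = (\<Sum>v\<in>E. (p v / total_rate) * ?E f + p y / total_rate * (F (v + 1) - F v))"
    using balance total_rate_pos
    by (intro sum.cong refl) (simp add: field_simps)
  also have "\<dots> = ?E f"
    by (simp only: sum.distrib sum_distrib_right[symmetric] sum_distrib_left[symmetric] weight_sum telescope mult_1_left mult_zero_right add_0_right)
  finally show ?thesis .
qed

lemma equilibrium_invariant_iter:
  assumes "\<And>x. 0 \<le> f x" "\<And>x. f x \<le> (B::real)"
  shows "measure_pmf.expectation equilibrium ((ring ^^ j) f) = measure_pmf.expectation equilibrium f"
proof (induction j)
  case (Suc j)
  have "(ring ^^ Suc j) f = ring ((ring ^^ j) f)" by simp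
  moreover have "measure_pmf.expectation equilibrium (ring ((ring ^^ j) f)) =
      measure_pmf.expectation equilibrium ((ring ^^ j) f)"
    by (rule equilibrium_invariant[where B = B]) (rule average_iter_bounds assms)+
  ultimately show ?case using Suc by simp
qed simp

end


section \<open>Coalescence and convergence to equilibrium\<close>

context tandem_queue begin

definition pair_hop :: "int \<Rightarrow> config \<times> config \<Rightarrow> config \<times> config" where
  "pair_hop v = map_prod (hop W v) (hop W v)"

abbreviation "pair_ring \<equiv> average E (\<lambda>v. p v / total_rate) pair_hop"

definition distinct_pair :: "config \<times> config \<Rightarrow> real" where
  "distinct_pair s = of_bool (fst s \<noteq> snd s)"

text \<open>Equality outside the window is required because a coupled pair can only merge inside it.\<close>
definition ordered_pairs :: "nat \<Rightarrow> (config \<times> config) set" where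
  "ordered_pairs D = {(x, z). z \<le> x \<and> (\<forall>u. u \<notin> W \<longrightarrow> x u = z u) \<and> mass W x \<le> mass W z + D}"

text \<open>The number of hops that the particles in the window need to leave it; a ring of a busy server
  lowers it by one.\<close>
definition distance_to_exit :: "config \<Rightarrow> nat" where
  "distance_to_exit x = (\<Sum>u\<in>W. nat (m + 1 - u) * x u)"

lemma distance_upd:
  assumes "u \<in> W"
  shows "distance_to_exit (x(u := k)) + nat (m + 1 - u) * x u = distance_to_exit x + nat (m + 1 - u) * k"
proof -
  let ?rest = "\<lambda>x. \<Sum>z\<in>W - {u}. nat (m + 1 - z) * x z"
  have split: "distance_to_exit x = nat (m + 1 - u) * x u + ?rest x" for x
    unfolding distance_to_exit_def by (rule sum.remove) (use assms in auto)
  have "?rest (x(u := k)) = ?rest x" by (rule sum.cong) auto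
  then show ?thesis unfolding split[of x] split[of "x(u := k)"] by (simp only: fun_upd_same) 
qed

lemma distance_hop:
  assumes "v \<in> W" "0 < x v"
  shows "Suc (distance_to_exit (hop W v x)) = distance_to_exit x"
proof -
  define c where "c u = nat (m + 1 - u)" for u
  let ?x = "x(v := x v - 1)"
  have upd: "distance_to_exit (x(u := k)) + c u * x u = distance_to_exit x + c u * k" if "u \<in> W" for u x k
    unfolding c_def by (rule distance_upd[OF that])
  obtain k where k: "x v = Suc k" using assms(2) by (cases "x v") auto
  have removed: "distance_to_exit ?x + c v = distance_to_exit x"
    using upd[OF assms(1), of x k] unfolding k by simp
  show ?thesis
  proof (cases "v + 1 \<in> W")
    case True
    have "c v = Suc (c (v + 1))" using True by (auto simp: c_def)
    moreover have "distance_to_exit (?x(v + 1 := Suc (?x (v + 1)))) = distance_to_exit ?x + c (v + 1)"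
      using upd[OF True, of ?x "Suc (?x (v + 1))"] by (simp only: mult_Suc_right)
    moreover have "hop W v x = ?x(v + 1 := Suc (?x (v + 1)))"
      using assms True by (simp only: hop_def deposit_def if_True not_True_eq_False if_False) simp
    ultimately show ?thesis using removed by (simp only: add_Suc_right)
  next
    case False
    then have "c v = 1" using assms(1) by (auto simp: c_def)
    moreover have "hop W v x = ?x"
      using assms False by (simp only: hop_def deposit_def if_True not_True_eq_False if_False) simp
    ultimately show ?thesis using removed by simp
  qed
qed

lemma distance_le: "distance_to_exit x \<le> nat (m - y) * mass W x"
proof -
  have "nat (m + 1 - u) * x u \<le> nat (m - y) * x u" if "u \<in> W" for u
    using that by (intro mult_le_mono1 nat_mono) auto
  then show ?thesis
    unfolding distance_to_exit_def mass_def sum_distrib_left by (rule sum_mono)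
qed

lemma pair_hop_ordered:
  assumes "s \<in> ordered_pairs D"
  shows "pair_hop v s \<in> ordered_pairs D"
proof -
  obtain x z where s: "s = (x, z)" by (cases s)
  have xz: "z \<le> x \<and> (\<forall>u. u \<notin> W \<longrightarrow> x u = z u) \<and> mass W x \<le> mass W z + D"
    using assms unfolding ordered_pairs_def s mem_Collect_eq prod.case .
  note le = conjunct1[OF xz] and out = conjunct1[OF conjunct2[OF xz]] and mass = conjunct2[OF conjunct2[OF xz]]
  have "hop W v z \<le> hop W v x" by (rule mono_hop[OF le])
  moreover have "mass W (hop W v x) \<le> mass W (hop W v z) + D"
    using mass_excess_hop[OF finite_greaterThanAtMost_int le, of y m v] mass by linarith
  moreover have "\<forall>u. u \<notin> W \<longrightarrow> hop W v x u = hop W v z u"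
  proof (intro allI impI)
    fix u assume u: "u \<notin> W"
    have "hop W v x u = x u" by (rule hop_outside[OF u])
    also have "\<dots> = z u" by (rule out[rule_format, OF u])
    also have "\<dots> = hop W v z u" by (rule hop_outside[OF u, symmetric])
    finally show "hop W v x u = hop W v z u" .
  qed
  ultimately show ?thesis
    unfolding ordered_pairs_def pair_hop_def s map_prod_simp
    by (intro CollectI case_prodI conjI)
qed

lemma coalesced_stays: "(pair_ring ^^ j) distinct_pair (x, x) = 0"
proof (rule antisym)
  have "(pair_ring ^^ j) distinct_pair (x, x) \<le> (pair_ring ^^ j) (\<lambda>_. 0) (x, x)"
    by (rule average_iter_mono[where S = "{(x, x) | x. True}"]) (auto simp: pair_hop_def distinct_pair_def)
  then show "(pair_ring ^^ j) distinct_pair (x, x) \<le> 0" by (simp add: average_iter_const)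
  show "0 \<le> (pair_ring ^^ j) distinct_pair (x, x)"
    by (rule average_iter_bounds(1)[where B = 1]) (simp_all add: distinct_pair_def)
qed

lemma distinct_prob_bounds:
  "0 \<le> (pair_ring ^^ j) distinct_pair s" "(pair_ring ^^ j) distinct_pair s \<le> 1"
  by (rule average_iter_bounds[where B = 1]; simp add: distinct_pair_def)+

definition min_weight :: real where
  "min_weight = Min ((\<lambda>v. p v / total_rate) ` E)"

lemma min_weight: "0 < min_weight" "min_weight \<le> 1" "v \<in> E \<Longrightarrow> min_weight \<le> p v / total_rate"
proof -
  have ne: "(\<lambda>v. p v / total_rate) ` E \<noteq> {}" "finite ((\<lambda>v. p v / total_rate) ` E)" using nonempty by auto
  show "0 < min_weight" unfolding min_weight_def using ne weight_pos by (subst Min_gr_iff) auto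
  show le: "min_weight \<le> p v / total_rate" if "v \<in> E" for v
    unfolding min_weight_def using ne that by (intro Min_le) auto
  have "p y / total_rate \<le> (\<Sum>v\<in>E. p v / total_rate)"
    using nonempty weight_pos by (intro member_le_sum) (auto intro: less_imp_le)
  then show "min_weight \<le> 1" using le[of y] nonempty weight_sum by auto
qed

text \<open>As long as the pair has not merged, the larger configuration has a particle in the window, and the
  ring of its site brings the window closer to being empty. With the smallest weight as a lower
  bound for each of these rings, an empty window, hence a merged pair, is reached within
  \<open>l\<close> rings.\<close>
lemma coalescence_prob:
  assumes "(x, z) \<in> ordered_pairs D" "distance_to_exit x \<le> l"
  shows "(pair_ring ^^ l) distinct_pair (x, z) \<le> 1 - min_weight ^ l"
  using assms
proof (induction l arbitrary: x z)
  case 0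
  have "x = z"
  proof
    fix u
    show "x u = z u"
    proof (cases "u \<in> W")
      case True
      then have "nat (m + 1 - u) * x u = 0" using 0 by (auto simp: distance_to_exit_def)
      moreover have "z u \<le> x u" using 0 by (auto simp: ordered_pairs_def le_fun_def)
      ultimately show ?thesis using True by auto
    qed (use 0 in \<open>auto simp: ordered_pairs_def\<close>)
  qed
  then show ?case by (simp add: distinct_pair_def)
next
  case (Suc l)
  show ?case
  proof (cases "x = z")
    case True
    then show ?thesis
      using coalesced_stays[of "Suc l" x] min_weight power_le_one[of min_weight "Suc l"] by simp
  next
    case False
    then obtain u where u: "x u \<noteq> z u" by auto
    then have W: "u \<in> W" and pos: "0 < x u" using Suc.prems by (auto simp: ordered_pairs_def le_fun_def)
      (metis le_0_eq neq0_conv)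
    let ?w = "\<lambda>v. p v / total_rate" and ?d = "(pair_ring ^^ l) distinct_pair"
    have u_E: "u \<in> E" using W by auto
    have step: "?d (pair_hop u (x, z)) \<le> 1 - min_weight ^ l"
    proof -
      have hops: "pair_hop u (x, z) = (hop W u x, hop W u z)" by (simp add: pair_hop_def)
      then have "(hop W u x, hop W u z) \<in> ordered_pairs D"
        using pair_hop_ordered[OF Suc.prems(1), of u] by simp
      moreover have "distance_to_exit (hop W u x) \<le> l"
        using distance_hop[of u x, OF W pos] Suc.prems(2) by simp
      ultimately show ?thesis unfolding hops by (rule Suc.IH)
    qed
    have "(pair_ring ^^ Suc l) distinct_pair (x, z) = 
      ?w u * ?d (pair_hop u (x, z)) + (\<Sum>v\<in>E - {u}. ?w v * ?d (pair_hop v (x, z)))"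
      using u_E by (simp add: average_def sum.remove)
    also have "\<dots> \<le> ?w u * (1 - min_weight ^ l) + (\<Sum>v\<in>E - {u}. ?w v * 1)"
      using u_E by (intro add_mono mult_left_mono sum_mono step distinct_prob_bounds less_imp_le[OF weight_pos]) auto
    also have "\<dots> = 1 - ?w u * min_weight ^ l"
      using weight_sum sum.remove[OF _ u_E, of ?w] by (simp add: right_diff_distrib)
    also have "\<dots> \<le> 1 - min_weight ^ Suc l"
      using mult_right_mono[OF min_weight(3)[OF u_E], of "min_weight ^ l"] min_weight(1) by simp
    finally show ?thesis .
  qed
qed

definition surplus_pair :: "config \<Rightarrow> config \<Rightarrow> config \<times> config" where
  "surplus_pair x z = (\<lambda>u. x u + z u, z)"

text \<open>The probability that a tandem in equilibrium and its copy with the additional particles \<open>x\<close> have not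
  merged after \<open>j\<close> rings.\<close>
definition discrepancy :: "config \<Rightarrow> nat \<Rightarrow> real" where
  "discrepancy x j =
     measure_pmf.expectation equilibrium (\<lambda>z. (pair_ring ^^ j) distinct_pair (surplus_pair x z))"

lemma surplus_pair_ordered:
  assumes "\<And>u. u \<notin> W \<Longrightarrow> x u = 0"
  shows "surplus_pair x z \<in> ordered_pairs (mass W x)"
  using assms by (auto simp: surplus_pair_def ordered_pairs_def le_fun_def mass_def sum.distrib)

lemma integrable_equilibrium:
  "(\<And>x. 0 \<le> g x) \<Longrightarrow> (\<And>x. g x \<le> (B::real)) \<Longrightarrow> integrable (measure_pmf equilibrium) g"
  by (rule measure_pmf.integrable_const_bound[where B = B]) auto

lemma iter_snd: "(pair_ring ^^ j) (\<lambda>s. F (snd s)) s = (ring ^^ j) F (snd s)"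
  by (rule average_iter_factor) (simp add: pair_hop_def)

lemma iter_fst: "(pair_ring ^^ j) (\<lambda>s. F (fst s)) s = (ring ^^ j) F (fst s)"
  by (rule average_iter_factor) (simp add: pair_hop_def)

lemma heavy_tail_vanishes:
  "(\<lambda>K. measure_pmf.prob equilibrium {z. K < mass W z + D}) \<longlonglongrightarrow> 0"
proof -
  have "(\<lambda>K. measure_pmf.prob equilibrium {z. K < mass W z + D}) \<longlonglongrightarrow>
      measure_pmf.prob equilibrium (\<Inter>K. {z. K < mass W z + D})"
    by (rule measure_pmf.finite_Lim_measure_decseq) (auto simp: decseq_def)
  also have "(\<Inter>K. {z. K < mass W z + D}) = {}" by auto
  finally show ?thesis by simp
qed

text \<open>Unless the larger configuration has mass above \<open>K\<close>, it empties within \<open>nat (m - y) * K\<close> further rings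
  with a probability that depends only on \<open>K\<close>. Its mass exceeds that of the smaller one by at most
  \<open>mass W x\<close>, and the smaller one is stationary, so a large mass has a small probability at all times.\<close>
lemma discrepancy_step:
  assumes x: "\<And>u. u \<notin> W \<Longrightarrow> x u = 0"
  defines "D \<equiv> mass W x"
  shows "discrepancy x (nat (m - y) * K + j) \<le>
    (1 - min_weight ^ (nat (m - y) * K)) * discrepancy x j
    + min_weight ^ (nat (m - y) * K) * measure_pmf.prob equilibrium {z. K < mass W z + D}"
proof -
  define l where "l = nat (m - y) * K"
  define d where "d = min_weight ^ l"
  have d: "0 \<le> d" "d \<le> 1" using min_weight by (auto simp: d_def power_le_one)
  let ?heavy = "\<lambda>z. of_bool (K < mass W z + D) :: real"
  have block: "(pair_ring ^^ l) distinct_pair s \<le> (1 - d) * distinct_pair s + d * ?heavy (snd s)"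
    if "s \<in> ordered_pairs D" for s
  proof -
    obtain x z where s: "s = (x, z)" by (cases s)
    consider "x = z" | "x \<noteq> z" "mass W x \<le> K" | "x \<noteq> z" "K < mass W x" by linarith
    then show ?thesis
    proof cases
      case 1
      then show ?thesis using d coalesced_stays[of l x] by (simp add: s distinct_pair_def)
    next
      case 2
      have "distance_to_exit x \<le> l"
        unfolding l_def by (rule le_trans[OF distance_le mult_le_mono2[OF 2(2)]])
      then show ?thesis
        using coalescence_prob[of x z D l] that 2 d by (simp add: s d_def distinct_pair_def)
    next
      case 3
      then have "K < mass W z + D" using that by (auto simp: s ordered_pairs_def)
      then show ?thesis using 3 distinct_prob_bounds[of l s] by (simp add: s distinct_pair_def)
    qed
  qed
  have pointwise: "(pair_ring ^^ (l + j)) distinct_pair (surplus_pair x z) \<le>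
      (1 - d) * (pair_ring ^^ j) distinct_pair (surplus_pair x z) + d * (ring ^^ j) ?heavy z" for z
  proof -
    have "(pair_ring ^^ (l + j)) distinct_pair (surplus_pair x z) =
        (pair_ring ^^ j) ((pair_ring ^^ l) distinct_pair) (surplus_pair x z)"
      by (simp add: add.commute[of l] funpow_add)
    also have "\<dots> \<le> (pair_ring ^^ j) (\<lambda>s. (1 - d) * distinct_pair s + d * ?heavy (snd s)) (surplus_pair x z)"
      by (rule average_iter_mono[where S = "ordered_pairs D"], erule pair_hop_ordered, erule block)
        (unfold D_def, rule surplus_pair_ordered, rule x)
    also have "\<dots> = (1 - d) * (pair_ring ^^ j) distinct_pair (surplus_pair x z) + d * (ring ^^ j) ?heavy z"
      by (subst average_iter_linear, subst iter_snd) (simp add: surplus_pair_def)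
    finally show ?thesis .
  qed
  have bounded: "0 \<le> (ring ^^ j) ?heavy z" "(ring ^^ j) ?heavy z \<le> 1" for z
    by (rule average_iter_bounds[where B = 1]; simp)+
  have int1: "integrable (measure_pmf equilibrium) (\<lambda>z. (pair_ring ^^ j) distinct_pair (surplus_pair x z))" for j
    by (rule integrable_equilibrium[where B = 1]) (rule distinct_prob_bounds)+
  have int2: "integrable (measure_pmf equilibrium) ((ring ^^ j) ?heavy)"
    by (rule integrable_equilibrium[where B = 1]) (rule bounded)+
  have "discrepancy x (l + j) \<le> measure_pmf.expectation equilibrium (\<lambda>z.
      (1 - d) * (pair_ring ^^ j) distinct_pair (surplus_pair x z) + d * (ring ^^ j) ?heavy z)"
    unfolding discrepancy_def by (intro integral_mono pointwise Bochner_Integration.integrable_add integrable_mult_right int1 int2)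
  also have "\<dots> = (1 - d) * discrepancy x j + d * measure_pmf.expectation equilibrium ((ring ^^ j) ?heavy)"
    unfolding discrepancy_def
    by (subst Bochner_Integration.integral_add) (use int1 int2 in auto)
  also have "measure_pmf.expectation equilibrium ((ring ^^ j) ?heavy) = measure_pmf.expectation equilibrium ?heavy"
    by (rule equilibrium_invariant_iter[where B = 1]) auto
  also have "?heavy = indicator {z. K < mass W z + D}" by (auto simp: indicator_def)
  finally show ?thesis by (simp add: l_def d_def)
qed

lemma discrepancy_vanishes:
  assumes x: "\<And>u. u \<notin> W \<Longrightarrow> x u = 0"
  shows "discrepancy x \<longlonglongrightarrow> 0"
proof -
  have nonneg: "0 \<le> discrepancy x j" for j
    unfolding discrepancy_def by (intro integral_nonneg_AE AE_I2 distinct_prob_bounds)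
  have "pair_ring distinct_pair s \<le> distinct_pair s" for s
    using distinct_prob_bounds(2)[of 1 s] coalesced_stays[of 1 "fst s"]
    by (cases "fst s = snd s"; cases s) (auto simp: distinct_pair_def)
  then have "(pair_ring ^^ j) (pair_ring distinct_pair) s \<le> (pair_ring ^^ j) distinct_pair s" for j s
    by (intro average_iter_mono[where S = UNIV]) auto
  then have "decseq (discrepancy x)"
    unfolding discrepancy_def
    by (intro decseq_SucI integral_mono integrable_equilibrium[where B = 1] distinct_prob_bounds)
      (simp add: funpow_swap1)
  then obtain L where L: "discrepancy x \<longlonglongrightarrow> L"
    using decseq_convergent[of "discrepancy x" 0] nonneg by blast
  have "L \<le> measure_pmf.prob equilibrium {z. K < mass W z + mass W x}" for K
  proof -
    define l where "l = nat (m - y) * K"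
    define d where "d = min_weight ^ l"
    let ?e = "measure_pmf.prob equilibrium {z. K < mass W z + mass W x}"
    have d: "0 < d" using min_weight by (simp add: d_def)
    have "L \<le> (1 - d) * L + d * ?e"
    proof (rule LIMSEQ_le)
      show "(\<lambda>j. discrepancy x (j + l)) \<longlonglongrightarrow> L" using L by (rule LIMSEQ_ignore_initial_segment)
      show "(\<lambda>j. (1 - d) * discrepancy x j + d * ?e) \<longlonglongrightarrow> (1 - d) * L + d * ?e"
        by (intro tendsto_intros L)
      show "\<exists>N. \<forall>n\<ge>N. discrepancy x (n + l) \<le> (1 - d) * discrepancy x n + d * ?e"
        using discrepancy_step[of x, OF x] by (simp add: d_def l_def add.commute)
    qed
    then have "d * L \<le> d * ?e" by (simp add: algebra_simps)
    then show ?thesis using d by simp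
  qed
  then have "L \<le> 0" by (intro LIMSEQ_le_const[OF heavy_tail_vanishes]) auto
  moreover have "0 \<le> L" by (intro LIMSEQ_le_const[OF L]) (use nonneg in auto)
  ultimately show ?thesis using L by simp
qed

text \<open>Adding the equilibrium to the initial state \<open>x\<close> only increases an increasing function, and puts the
  chain in a coupling with the stationary one.\<close>
lemma ring_iter_le_equilibrium:
  assumes f: "mono f" "\<And>x. 0 \<le> f x" "\<And>x. f x \<le> (B::real)"
    and x: "\<And>u. u \<notin> W \<Longrightarrow> x u = 0"
  shows "(ring ^^ j) f x \<le> measure_pmf.expectation equilibrium f + B * discrepancy x j"
proof -
  have B: "0 \<le> B" using f(2,3)[of "\<lambda>_. 0"] by linarith
  have mono_iter: "(ring ^^ j) f x \<le> (ring ^^ j) f x'" if "x \<le> x'" for x x'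
  proof -
    have "(pair_ring ^^ j) (\<lambda>s. f (snd s)) (x', x) \<le> (pair_ring ^^ j) (\<lambda>s. f (fst s)) (x', x)"
      by (rule average_iter_mono[where S = "{(x', x). x \<le> x'}"])
        (use that in \<open>auto simp: pair_hop_def intro: mono_hop monoD[OF f(1)]\<close>)
    then show ?thesis by (simp add: iter_fst iter_snd)
  qed
  have pointwise: "(ring ^^ j) f x \<le>
      (ring ^^ j) f z + B * (pair_ring ^^ j) distinct_pair (surplus_pair x z)" for z
  proof -
    let ?s = "surplus_pair x z"
    have "(ring ^^ j) f x \<le> (ring ^^ j) f (fst ?s)"
      by (rule mono_iter) (simp add: surplus_pair_def le_fun_def)
    also have "\<dots> = (pair_ring ^^ j) (\<lambda>s. f (fst s)) ?s"
      by (simp add: iter_fst)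
    also have "\<dots> \<le> (pair_ring ^^ j) (\<lambda>s. 1 * f (snd s) + B * distinct_pair s) ?s"
    proof (rule average_iter_mono[where S = UNIV])
      fix s show "f (fst s) \<le> 1 * f (snd s) + B * distinct_pair s"
        using f(2)[of "snd s"] f(3)[of "fst s"] by (cases "fst s = snd s") (auto simp: distinct_pair_def)
    qed auto
    also have "\<dots> = 1 * (pair_ring ^^ j) (\<lambda>s. f (snd s)) ?s + B * (pair_ring ^^ j) distinct_pair ?s"
      by (rule average_iter_linear)
    also have "(pair_ring ^^ j) (\<lambda>s. f (snd s)) ?s = (ring ^^ j) f z"
      by (simp add: iter_snd surplus_pair_def)
    finally show ?thesis by simp
  qed
  have int1: "integrable (measure_pmf equilibrium) (\<lambda>z. (pair_ring ^^ j) distinct_pair (surplus_pair x z))"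
    by (rule integrable_equilibrium[where B = 1]) (rule distinct_prob_bounds)+
  have int2: "integrable (measure_pmf equilibrium) ((ring ^^ j) f)"
    by (rule integrable_equilibrium[where B = B]) (rule average_iter_bounds f)+
  have "(ring ^^ j) f x = measure_pmf.expectation equilibrium (\<lambda>_. (ring ^^ j) f x)" by simp
  also have "\<dots> \<le> measure_pmf.expectation equilibrium
      (\<lambda>z. (ring ^^ j) f z + B * (pair_ring ^^ j) distinct_pair (surplus_pair x z))"
    by (intro integral_mono pointwise) (use int1 int2 in auto)
  also have "\<dots> = measure_pmf.expectation equilibrium ((ring ^^ j) f) + B * discrepancy x j"
    unfolding discrepancy_def by (subst Bochner_Integration.integral_add) (use int1 int2 in auto)
  finally show ?thesis by (simp add: equilibrium_invariant_iter[OF f(2,3)])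
qed

lemma ring_iter_heavy_le:
  assumes x: "\<And>u. u \<notin> W \<Longrightarrow> x u = 0"
  shows "(ring ^^ j) (\<lambda>x. of_bool (K < mass W x)) x \<le>
    measure_pmf.prob equilibrium {z. K < mass W z + mass W x}"
proof -
  define D where "D = mass W x"
  let ?heavy = "\<lambda>x. of_bool (K < mass W x) :: real"
  let ?heavier = "\<lambda>x. of_bool (K < mass W x + D) :: real"
  have pointwise: "(ring ^^ j) ?heavy x \<le> (ring ^^ j) ?heavier z" for z
  proof -
    let ?s = "surplus_pair x z"
    have "(pair_ring ^^ j) (\<lambda>s. ?heavy (snd s)) (fst ?s, x) \<le> (pair_ring ^^ j) (\<lambda>s. ?heavy (fst s)) (fst ?s, x)"
    proof (rule average_iter_mono[where S = "{(x', x). x \<le> x'}"])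
      fix s :: "config \<times> config" assume "s \<in> {(x', x). x \<le> x'}"
      then show "?heavy (snd s) \<le> ?heavy (fst s)" using mass_mono[of "snd s" "fst s" W] by auto
    next
      show "(fst ?s, x) \<in> {(x', x). x \<le> x'}" by (simp add: surplus_pair_def le_fun_def)
    qed (auto simp: pair_hop_def intro: mono_hop)
    then have "(ring ^^ j) ?heavy x \<le> (ring ^^ j) ?heavy (fst ?s)" by (simp only: iter_fst[of j ?heavy] iter_snd[of j ?heavy] fst_conv snd_conv)
    also have "\<dots> = (pair_ring ^^ j) (\<lambda>s. ?heavy (fst s)) ?s"
      by (rule iter_fst[of j ?heavy, symmetric])
    also have "\<dots> \<le> (pair_ring ^^ j) (\<lambda>s. ?heavier (snd s)) ?s"
    proof (rule average_iter_mono[where S = "ordered_pairs D"])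
      show "?s \<in> ordered_pairs D" unfolding D_def by (rule surplus_pair_ordered) (rule x)
      show "?heavy (fst s) \<le> ?heavier (snd s)" if "s \<in> ordered_pairs D" for s
        using that by (auto simp: ordered_pairs_def)
    qed (rule pair_hop_ordered)
    also have "\<dots> = (ring ^^ j) ?heavier z"
      by (simp only: iter_snd[of j ?heavier] surplus_pair_def snd_conv)
    finally show ?thesis .
  qed
  have "(ring ^^ j) ?heavy x = measure_pmf.expectation equilibrium (\<lambda>_. (ring ^^ j) ?heavy x)" by simp
  also have "\<dots> \<le> measure_pmf.expectation equilibrium ((ring ^^ j) ?heavier)"
    by (intro integral_mono pointwise integrable_equilibrium[where B = 1] average_iter_bounds) auto
  also have "\<dots> = measure_pmf.expectation equilibrium ?heavier"
    by (rule equilibrium_invariant_iter[where B = 1]) auto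
  also have "?heavier = indicator {z. K < mass W z + D}" by (auto simp: indicator_def)
  finally show ?thesis by (simp add: D_def)
qed

end


section \<open>Paths between rings of the clocks\<close>

lemma locally_constant_on_interval:
  fixes g :: "real \<Rightarrow> 'b::discrete_topology"
  assumes "s \<le> t"
    and right: "\<And>r. r \<in> {s..<t} \<Longrightarrow> continuous (at_right r) g"
    and left: "\<And>r. r \<in> {s<..t} \<Longrightarrow> continuous (at_left r) g"
  shows "g s = g t"
proof (rule connected_local_const[of "{s..t}"])
  show "\<forall>a\<in>{s..t}. \<forall>\<^sub>F b in at a within {s..t}. g a = g b"
  proof
    fix a assume a: "a \<in> {s..t}"
    have R: "\<forall>\<^sub>F b in at_right a. g a = g b" if "a < t"
      using right[of a] a that by (auto simp: continuous_within tendsto_discrete eq_commute)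
    have L: "\<forall>\<^sub>F b in at_left a. g a = g b" if "s < a"
      using left[of a] a that by (auto simp: continuous_within tendsto_discrete eq_commute)
    consider "s = t" | "s < t" "a = s" | "s < t" "a = t" | "s < a" "a < t" using a by fastforce
    then show "\<forall>\<^sub>F b in at a within {s..t}. g a = g b"
    proof cases
      case 1
      then show ?thesis using a by (auto simp: eventually_at intro!: exI[of _ 1])
    next
      case 4
      then have "\<forall>\<^sub>F b in at a. g a = g b" using L R by (simp add: eventually_at_split)
      then show ?thesis by (rule filter_leD[OF at_le, rotated]) simp
    qed (use L R in \<open>simp_all add: at_within_Icc_at_right at_within_Icc_at_left\<close>)
  qed
qed (use assms in auto)

lemma tendsto_coordinate:
  fixes f :: "'c \<Rightarrow> 'd \<Rightarrow> 'b::topological_space"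
  assumes "(f \<longlongrightarrow> l) F"
  shows "((\<lambda>r. f r w) \<longlongrightarrow> l w) F"
  using continuous_on_tendsto_compose[OF continuous_on_product_coordinates assms, of w] by simp

lemma constant_no_jump:
  assumes mono: "mono_on {0..} n" and "n s = n t" "0 \<le> s" "r \<in> {s<..t}"
  shows "\<not> jumps_at n r"
proof -
  have "n u = n r" if "u \<in> {s<..<r}" for u
    using mono_onD[OF mono, of s u] mono_onD[OF mono, of u r] mono_onD[OF mono, of r t] assms that by auto
  then have "\<forall>\<^sub>F u in at_left r. n u = n r"
    by (intro eventually_at_leftI[of s]) (use assms in auto)
  then show ?thesis by (simp add: jumps_at_def continuous_within tendsto_discrete)
qed

text \<open>The topology on configurations is that of pointwise convergence, so a left limit is attained
  eventually at every single site, though not uniformly over the sites.\<close>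
lemma zero_range_path_jump:
  assumes "zero_range_path n \<eta>" "0 < u"
  shows "\<exists>\<xi>. (\<forall>w. \<forall>\<^sub>F r in at_left u. \<eta> r w = \<xi> w) \<and>
    (\<forall>x. jumps_at (n x) u \<and> 0 < \<xi> x \<longrightarrow> \<eta> u = move x \<xi>) \<and>
    (\<eta> u \<noteq> \<xi> \<longrightarrow> (\<exists>x. jumps_at (n x) u \<and> 0 < \<xi> x))"
proof -
  obtain \<xi> where lim: "(\<eta> \<longlongrightarrow> \<xi>) (at_left u)"
    and jump: "\<forall>x. jumps_at (n x) u \<and> \<xi> x > 0 \<longrightarrow> \<eta> u = move x \<xi>"
    and still: "(\<forall>x. \<not> (jumps_at (n x) u \<and> \<xi> x > 0)) \<longrightarrow> \<eta> u = \<xi>"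
    using assms unfolding zero_range_path_def by blast
  have "\<forall>\<^sub>F r in at_left u. \<eta> r w = \<xi> w" for w
    using tendsto_coordinate[OF lim, of w] by (simp add: tendsto_discrete)
  then show ?thesis using jump still by blast
qed

lemma move_unaffected: "w \<noteq> x \<Longrightarrow> w \<noteq> x + 1 \<Longrightarrow> move x \<xi> w = \<xi> w"
  by (simp add: move_def)

lemma quiet_site_constant:
  assumes path: "zero_range_path n \<eta>"
    and mono: "\<And>x. x \<in> {w - 1, w} \<Longrightarrow> mono_on {0..} (n x)"
    and quiet: "\<And>x. x \<in> {w - 1, w} \<Longrightarrow> n x s = n x t"
    and "0 \<le> s" "s \<le> t"
  shows "\<eta> s w = \<eta> t w"
proof (rule locally_constant_on_interval[OF \<open>s \<le> t\<close>])
  fix r assume r: "r \<in> {s..<t}"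
  have "(\<eta> \<longlongrightarrow> \<eta> r) (at_right r)"
    using path r \<open>0 \<le> s\<close> unfolding zero_range_path_def by (auto simp: continuous_within)
  then show "continuous (at_right r) (\<lambda>r. \<eta> r w)"
    unfolding continuous_within by (rule tendsto_coordinate)
next
  fix r assume r: "r \<in> {s<..t}"
  have calm: "\<not> jumps_at (n x) r" if "x \<in> {w - 1, w}" for x
    by (rule constant_no_jump[OF mono quiet]) (use that r \<open>0 \<le> s\<close> in auto)
  have "0 < r" using r \<open>0 \<le> s\<close> by auto
  obtain \<xi> where ev: "\<And>w. \<forall>\<^sub>F r in at_left r. \<eta> r w = \<xi> w"
    and jump: "\<And>x. jumps_at (n x) r \<Longrightarrow> 0 < \<xi> x \<Longrightarrow> \<eta> r = move x \<xi>"
    and still: "\<eta> r \<noteq> \<xi> \<Longrightarrow> \<exists>x. jumps_at (n x) r \<and> 0 < \<xi> x"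
    using zero_range_path_jump[OF path \<open>0 < r\<close>] by blast
  have "\<eta> r w = \<xi> w"
  proof (cases "\<eta> r = \<xi>")
    case False
    then obtain x where x: "jumps_at (n x) r" "0 < \<xi> x" using still by blast
    then have "x \<notin> {w - 1, w}" using calm by blast
    then show ?thesis using jump[OF x] by (simp add: move_unaffected)
  qed simp
  then show "continuous (at_left r) (\<lambda>r. \<eta> r w)"
    using ev[of w] by (simp add: continuous_within tendsto_discrete)
qed

text \<open>The clock \<open>v\<close> rings at exactly one time \<open>u\<close>. Before and after \<open>u\<close> the sites in the window do not change,
  and at \<open>u\<close> the only jumps that can interfere start at sites outside \<open>{y..m}\<close>, whose targets also lie
  outside \<open>{y<..m}\<close>. The configuration \<open>\<xi>\<close> is the left limit at \<open>u\<close>; at the source \<open>y\<close> it may differ from the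
  configuration at time \<open>s\<close>.\<close>
lemma single_ring_path:
  fixes y m :: int
  assumes path: "zero_range_path n \<eta>"
    and mono: "\<And>x. x \<in> {y..m} \<Longrightarrow> mono_on {0..} (n x)"
    and right: "\<And>r. 0 \<le> r \<Longrightarrow> continuous (at_right r) (n v)"
    and v: "v \<in> {y..m}" "n v t = Suc (n v s)"
    and others: "\<And>x. x \<in> {y..m} \<Longrightarrow> x \<noteq> v \<Longrightarrow> n x s = n x t"
    and "0 \<le> s" "s < t"
  shows "\<exists>\<xi>. \<forall>w\<in>{y<..m}. \<xi> w = \<eta> s w \<and> \<eta> t w = (if 0 < \<xi> v then move v \<xi> w else \<xi> w)"
proof -
  have "\<exists>u\<in>{s<..t}. jumps_at (n v) u"
  proof (rule ccontr)
    assume "\<not> ?thesis"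
    then have "n v s = n v t"
      by (intro locally_constant_on_interval) (use right \<open>0 \<le> s\<close> \<open>s < t\<close> in \<open>auto simp: jumps_at_def\<close>)
    then show False using v by simp
  qed
  then obtain u where u: "s < u" "u \<le> t" and jump_u: "jumps_at (n v) u" by auto
  have "0 < u" using u \<open>0 \<le> s\<close> by simp
  have mono_le: "n x a \<le> n x b" if "x \<in> {y..m}" "0 \<le> a" "a \<le> b" for x a b
    using mono_onD[OF mono[OF that(1)], of a b] that by simp
  have before: "n v r = n v s" if "s \<le> r" "r < u" for r
  proof -
    have "n v r \<noteq> n v t"
      using constant_no_jump[OF mono[OF v(1)], of r t u] that u jump_u \<open>0 \<le> s\<close> by auto
    moreover have "n v s \<le> n v r" "n v r \<le> n v t"
      using that u \<open>0 \<le> s\<close> by (auto intro: mono_le[OF v(1)])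
    ultimately show ?thesis using v(2) by linarith
  qed
  have after: "n v u = n v t"
  proof -
    have "n v s \<noteq> n v u"
      using constant_no_jump[OF mono[OF v(1)], of s u u] u jump_u \<open>0 \<le> s\<close> by auto
    moreover have "n v s \<le> n v u" "n v u \<le> n v t"
      using u \<open>0 \<le> s\<close> by (auto intro: mono_le[OF v(1)])
    ultimately show ?thesis using v(2) by linarith
  qed
  have others_const: "n x r = n x s" if "x \<in> {y..m}" "x \<noteq> v" "s \<le> r" "r \<le> t" for x r
    using mono_le[OF that(1), of s r] mono_le[OF that(1), of r t] others[of x] that \<open>0 \<le> s\<close> by simp
  have still_before: "\<eta> r w = \<eta> s w" if w: "w \<in> {y<..m}" and r: "s \<le> r" "r < u" for r w
  proof -
    have sub: "x \<in> {y..m}" if "x \<in> {w - 1, w}" for x using that w by auto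
    have "\<eta> s w = \<eta> r w"
    proof (rule quiet_site_constant[OF path])
      show "n x s = n x r" if "x \<in> {w - 1, w}" for x
        using before[OF r] others_const[of x r] sub[OF that] r u by (cases "x = v") auto
    qed (use mono sub \<open>0 \<le> s\<close> r in auto)
    then show ?thesis ..
  qed
  have still_after: "\<eta> t w = \<eta> u w" if w: "w \<in> {y<..m}" for w
  proof -
    have sub: "x \<in> {y..m}" if "x \<in> {w - 1, w}" for x using that w by auto
    have "\<eta> u w = \<eta> t w"
    proof (rule quiet_site_constant[OF path])
      show "n x u = n x t" if "x \<in> {w - 1, w}" for x
        using after others_const[of x u] others_const[of x t] sub[OF that] u \<open>s < t\<close> by (cases "x = v") auto
    qed (use mono sub \<open>0 \<le> s\<close> u in auto)
    then show ?thesis ..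
  qed
  obtain \<xi> where ev: "\<And>w. \<forall>\<^sub>F r in at_left u. \<eta> r w = \<xi> w"
    and jump: "\<And>x. jumps_at (n x) u \<Longrightarrow> 0 < \<xi> x \<Longrightarrow> \<eta> u = move x \<xi>"
    and still: "\<eta> u \<noteq> \<xi> \<Longrightarrow> \<exists>x. jumps_at (n x) u \<and> 0 < \<xi> x"
    using zero_range_path_jump[OF path \<open>0 < u\<close>] by blast
  show ?thesis
  proof (intro exI[of _ \<xi>] ballI conjI)
    fix w assume w: "w \<in> {y<..m}"
    have "\<forall>\<^sub>F r in at_left u. \<eta> r w = \<eta> s w"
    proof (rule eventually_at_leftI[of s])
      show "\<eta> r w = \<eta> s w" if "r \<in> {s<..<u}" for r
        by (rule still_before[OF w]) (use that in auto)
    qed (use u in auto)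
    then have "\<forall>\<^sub>F r in at_left u. \<xi> w = \<eta> s w"
      using ev[of w] by eventually_elim simp
    then show "\<xi> w = \<eta> s w" by simp
    have "\<eta> u w = (if 0 < \<xi> v then move v \<xi> w else \<xi> w)"
    proof (cases "0 < \<xi> v \<or> \<eta> u = \<xi>")
      case True
      then show ?thesis using jump[OF jump_u] by auto
    next
      case False
      then obtain x where x: "jumps_at (n x) u" "0 < \<xi> x" using still by blast
      have "x \<notin> {y..m}"
      proof
        assume E: "x \<in> {y..m}"
        have "x \<noteq> v" using False x by auto
        then show False
          using constant_no_jump[OF mono[OF E] others[OF E] \<open>0 \<le> s\<close>, of u] x(1) u by auto
      qed
      then have "w \<noteq> x" "w \<noteq> x + 1" using w by auto
      then show ?thesis using jump[OF x] False by (simp add: move_unaffected)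
    qed
    then show "\<eta> t w = (if 0 < \<xi> v then move v \<xi> w else \<xi> w)" using still_after[OF w] by simp
  qed
qed

lemma single_ring_dominated:
  fixes y m :: int
  assumes path: "zero_range_path n \<eta>"
    and mono: "\<And>x. x \<in> {y..m} \<Longrightarrow> mono_on {0..} (n x)"
    and right: "\<And>r. 0 \<le> r \<Longrightarrow> continuous (at_right r) (n v)"
    and v: "v \<in> {y..m}" "n v t = Suc (n v s)"
    and others: "\<And>x. x \<in> {y..m} \<Longrightarrow> x \<noteq> v \<Longrightarrow> n x s = n x t"
    and "0 \<le> s" "s < t"
    and le: "\<And>w. w \<in> {y<..m} \<Longrightarrow> \<eta> s w \<le> X w"
    and w: "w \<in> {y<..m}"
  shows "\<eta> t w \<le> hop {y<..m} v X w"
proof -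
  have "\<exists>\<xi>. \<forall>w\<in>{y<..m}. \<xi> w = \<eta> s w \<and> \<eta> t w = (if 0 < \<xi> v then move v \<xi> w else \<xi> w)"
    by (rule single_ring_path[OF path _ _ v _ \<open>0 \<le> s\<close> \<open>s < t\<close>]) (use mono right others in auto)
  then obtain \<xi> where start: "\<And>w. w \<in> {y<..m} \<Longrightarrow> \<xi> w = \<eta> s w"
    and final: "\<And>w. w \<in> {y<..m} \<Longrightarrow> \<eta> t w = (if 0 < \<xi> v then move v \<xi> w else \<xi> w)"
    by blast
  have \<xi>: "\<xi> w \<le> X w" using start[OF w] le[OF w] by simp
  show ?thesis
  proof (cases "v \<in> {y<..m}")
    case True
    then have "\<xi> v \<le> X v" using start le by simp
    then show ?thesis
      using \<xi> w True final[OF w] by (auto simp: hop_def deposit_def move_def)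
  next
    case False
    then show ?thesis
      using \<xi> w final[OF w] v by (auto simp: hop_def deposit_def move_def)
  qed
qed


section \<open>Chains driven by independent marks\<close>

text \<open>The mark \<open>None\<close> stands for a time cell in which nothing is moved.\<close>
primrec run :: "('v \<Rightarrow> 's \<Rightarrow> 's) \<Rightarrow> 's \<Rightarrow> (nat \<Rightarrow> 'v option) \<Rightarrow> nat \<Rightarrow> 's" where
  "run h x g 0 = x"
| "run h x g (Suc i) = (case g i of None \<Rightarrow> run h x g i | Some v \<Rightarrow> h v (run h x g i))"

lemma run_cong: "(\<And>j. j < i \<Longrightarrow> g j = g' j) \<Longrightarrow> run h x g i = run h x g' i"
  by (induction i) (simp_all split: option.split)

lemma (in prob_space) measurable_run:
  fixes U :: "nat \<Rightarrow> 'a \<Rightarrow> 'v::countable option"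
  assumes "\<And>j. j < i \<Longrightarrow> random_variable (count_space UNIV) (U j)"
  shows "random_variable (count_space UNIV) (\<lambda>\<omega>. run h x (\<lambda>j. U j \<omega>) i)"
  using assms
proof (induction i)
  case (Suc i)
  have "random_variable (count_space UNIV) (\<lambda>\<omega>. (\<lambda>u s. case u of None \<Rightarrow> s | Some v \<Rightarrow> h v s) (U i \<omega>) (run h x (\<lambda>j. U j \<omega>) i))"
    by (rule measurable_compose_countable[where g = "U i"])
      (auto intro!: measurable_compose[OF Suc.IH] Suc.prems)
  then show ?case by simp
qed simp

text \<open>The mark of a cell is independent of the state reached before it, so the expectation is obtained
  by applying the lazy averaging operator once per cell.\<close>
lemma (in prob_space) expectation_run:
  fixes U :: "nat \<Rightarrow> 'a \<Rightarrow> 'v::countable option"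
  assumes indep: "indep_vars (\<lambda>_. count_space UNIV) U {..<n}"
    and updates: "random_updates V w"
    and range: "\<And>i \<omega>. i < n \<Longrightarrow> \<omega> \<in> space M \<Longrightarrow> U i \<omega> \<in> insert None (Some ` V)"
    and law: "\<And>i v. i < n \<Longrightarrow> v \<in> V \<Longrightarrow> prob {\<omega>\<in>space M. U i \<omega> = Some v} = \<theta> * w v"
    and \<theta>: "0 \<le> \<theta>" "\<theta> \<le> 1"
    and f: "\<And>x. 0 \<le> f x" "\<And>x. f x \<le> B"
  shows "expectation (\<lambda>\<omega>. f (run h x (\<lambda>j. U j \<omega>) n)) = (lazy_average V w h \<theta> ^^ n) f x"
proof -
  interpret random_updates V w by (rule updates)
  have U: "random_variable (count_space UNIV) (U i)" if "i < n" for i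
    using indep that by (auto simp: indep_vars_def)
  let ?X = "\<lambda>i \<omega>. run h x (\<lambda>j. U j \<omega>) i"
  let ?Q = "lazy_average V w h \<theta>"
  have X: "random_variable (count_space UNIV) (?X i)" if "i \<le> n" for i
    using that by (intro measurable_run U) auto
  have int: "integrable M (\<lambda>\<omega>. g (?X i \<omega>))"
    if "i \<le> n" "\<And>x. 0 \<le> g x" "\<And>x. g x \<le> B" for i and g :: "'b \<Rightarrow> real"
    by (rule integrable_const_bound[where B = B]) (use that measurable_compose[OF X[OF that(1)], of g borel] in auto)
  have law_None: "prob {\<omega>\<in>space M. U i \<omega> = None} = 1 - \<theta>" if "i < n" for i
  proof -
    have ev: "{\<omega>\<in>space M. U i \<omega> = u} \<in> events" for u
      using measurable_sets[OF U[OF that], of "{u}"] by (simp add: vimage_def Int_def conj_commute)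
    have "prob (\<Union>u\<in>insert None (Some ` V). {\<omega>\<in>space M. U i \<omega> = u}) =
        (\<Sum>u\<in>insert None (Some ` V). prob {\<omega>\<in>space M. U i \<omega> = u})"
      using finite_updates ev by (intro finite_measure_finite_Union) (auto simp: disjoint_family_on_def)
    also have "(\<Union>u\<in>insert None (Some ` V). {\<omega>\<in>space M. U i \<omega> = u}) = space M"
      using range[OF that] by auto
    finally have "1 = prob {\<omega>\<in>space M. U i \<omega> = None} + (\<Sum>v\<in>V. \<theta> * w v)"
      using finite_updates law[OF that] by (simp add: prob_space sum.reindex)
    then show ?thesis by (simp add: weight_sum flip: sum_distrib_left)
  qed
  have split: "expectation (\<lambda>\<omega>. of_bool (U i \<omega> = u) * g (?X i \<omega>)) =
      prob {\<omega>\<in>space M. U i \<omega> = u} * expectation (\<lambda>\<omega>. g (?X i \<omega>))"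
    if "i < n" and g: "\<And>x. 0 \<le> g x" "\<And>x. g x \<le> B" for i u and g :: "'b \<Rightarrow> real"
  proof -
    have PiM: "PiM A (\<lambda>_. count_space UNIV) = count_space (PiE A (\<lambda>_. UNIV :: 'v option set))"
      if "finite A" for A :: "nat set"
      using that by (intro count_space_PiM_finite) auto
    have "indep_var (PiM {i} (\<lambda>_. count_space UNIV)) (\<lambda>\<omega>. restrict (\<lambda>j. U j \<omega>) {i})
      (PiM {..<i} (\<lambda>_. count_space UNIV)) (\<lambda>\<omega>. restrict (\<lambda>j. U j \<omega>) {..<i})"
      using indep by (rule indep_var_restrict) (use that in auto)
    then have "indep_var borel ((\<lambda>r. of_bool (r i = u)) \<circ> (\<lambda>\<omega>. restrict (\<lambda>j. U j \<omega>) {i}))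
        borel ((\<lambda>r. g (run h x r i)) \<circ> (\<lambda>\<omega>. restrict (\<lambda>j. U j \<omega>) {..<i}))"
      by (rule indep_var_compose) (simp_all add: PiM)
    moreover have "(\<lambda>r. g (run h x r i)) \<circ> (\<lambda>\<omega>. restrict (\<lambda>j. U j \<omega>) {..<i}) = (\<lambda>\<omega>. g (?X i \<omega>))"
      by (auto simp: fun_eq_iff intro!: arg_cong[where f = g] run_cong)
    ultimately have "indep_var borel (\<lambda>\<omega>. of_bool (U i \<omega> = u) :: real) borel (\<lambda>\<omega>. g (?X i \<omega>))"
      by (simp add: comp_def)
    moreover have of_bool: "(\<lambda>\<omega>. of_bool (U i \<omega> = u) :: real) \<in> borel_measurable M"
      using measurable_compose[OF U[OF that(1)], of "\<lambda>v. of_bool (v = u)" borel] by simp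
    moreover have "integrable M (\<lambda>\<omega>. of_bool (U i \<omega> = u) :: real)"
      by (rule integrable_const_bound[where B = 1]) (use of_bool in auto)
    moreover have "integrable M (\<lambda>\<omega>. g (?X i \<omega>))" using that by (intro int) auto
    ultimately have "expectation (\<lambda>\<omega>. of_bool (U i \<omega> = u) * g (?X i \<omega>)) =
        expectation (\<lambda>\<omega>. of_bool (U i \<omega> = u)) * expectation (\<lambda>\<omega>. g (?X i \<omega>))"
      by (intro indep_var_lebesgue_integral)
    also have "expectation (\<lambda>\<omega>. of_bool (U i \<omega> = u) :: real) = expectation (indicator {\<omega>\<in>space M. U i \<omega> = u})"
      by (intro Bochner_Integration.integral_cong) (auto simp: indicator_def)
    also have "\<dots> = prob {\<omega>\<in>space M. U i \<omega> = u}"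
      by (auto intro!: arg_cong[where f = prob])
    finally show ?thesis .
  qed
  have int_split: "integrable M (\<lambda>\<omega>. of_bool (U i \<omega> = u) * g (?X i \<omega>))"
    if "i < n" and g: "\<And>x. 0 \<le> g x" "\<And>x. g x \<le> B" for i u and g :: "'b \<Rightarrow> real"
  proof (rule integrable_const_bound[where B = B])
    have "(\<lambda>\<omega>. of_bool (U i \<omega> = u) :: real) \<in> borel_measurable M"
      using measurable_compose[OF U[OF that(1)], of "\<lambda>v. of_bool (v = u)" borel] by simp
    moreover have "(\<lambda>\<omega>. g (?X i \<omega>)) \<in> borel_measurable M"
      using measurable_compose[OF X, of i g borel] that(1) by simp
    ultimately show "(\<lambda>\<omega>. of_bool (U i \<omega> = u) * g (?X i \<omega>)) \<in> borel_measurable M" by simp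
    have "0 \<le> B" using g[of x] by linarith
    then show "AE \<omega> in M. norm (of_bool (U i \<omega> = u) * g (?X i \<omega>)) \<le> B" using g by auto
  qed
  have step: "expectation (\<lambda>\<omega>. g (?X (Suc i) \<omega>)) = expectation (\<lambda>\<omega>. ?Q g (?X i \<omega>))"
    if "i < n" and g: "\<And>x. 0 \<le> g x" "\<And>x. g x \<le> B" for i and g :: "'b \<Rightarrow> real"
  proof -
    have "g (?X (Suc i) \<omega>) = of_bool (U i \<omega> = None) * g (?X i \<omega>) +
        (\<Sum>v\<in>V. of_bool (U i \<omega> = Some v) * g (h v (?X i \<omega>)))" if "\<omega> \<in> space M" for \<omega>
    proof (cases "U i \<omega>")
      case (Some v)
      then have "v \<in> V" using range[OF \<open>i < n\<close> that] by auto
      have "(\<Sum>v'\<in>V. of_bool (U i \<omega> = Some v') * g (h v' (?X i \<omega>))) =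
          (\<Sum>v'\<in>V. if v = v' then g (h v (?X i \<omega>)) else 0)"
        using Some by (intro sum.cong) auto
      also have "\<dots> = g (h v (?X i \<omega>))" using \<open>v \<in> V\<close> finite_updates by simp
      finally show ?thesis using Some by simp
    qed simp
    then have "expectation (\<lambda>\<omega>. g (?X (Suc i) \<omega>)) = expectation (\<lambda>\<omega>. of_bool (U i \<omega> = None) * g (?X i \<omega>) +
        (\<Sum>v\<in>V. of_bool (U i \<omega> = Some v) * g (h v (?X i \<omega>))))"
      by (intro Bochner_Integration.integral_cong refl) simp
    also have "\<dots> = expectation (\<lambda>\<omega>. of_bool (U i \<omega> = None) * g (?X i \<omega>)) +
        (\<Sum>v\<in>V. expectation (\<lambda>\<omega>. of_bool (U i \<omega> = Some v) * g (h v (?X i \<omega>))))"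
      by (subst Bochner_Integration.integral_add)
        (auto intro!: Bochner_Integration.integrable_sum int_split that simp: Bochner_Integration.integral_sum
          int_split[OF that(1), of "\<lambda>s. g (h _ s)"] g)
    also have "\<dots> = (1 - \<theta>) * expectation (\<lambda>\<omega>. g (?X i \<omega>)) +
        (\<Sum>v\<in>V. \<theta> * w v * expectation (\<lambda>\<omega>. g (h v (?X i \<omega>))))"
    proof (intro arg_cong2[where f = "(+)"] sum.cong refl)
      show "expectation (\<lambda>\<omega>. of_bool (U i \<omega> = None) * g (?X i \<omega>)) = (1 - \<theta>) * expectation (\<lambda>\<omega>. g (?X i \<omega>))"
        using split[OF that(1), of g None] g law_None[OF that(1)] by simp
      show "expectation (\<lambda>\<omega>. of_bool (U i \<omega> = Some v) * g (h v (?X i \<omega>))) =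
          \<theta> * w v * expectation (\<lambda>\<omega>. g (h v (?X i \<omega>)))" if "v \<in> V" for v
        using split[OF \<open>i < n\<close>, of "\<lambda>s. g (h v s)" "Some v"] g law[OF \<open>i < n\<close> that] by simp
    qed
    also have "\<dots> = expectation (\<lambda>\<omega>. (1 - \<theta>) * g (?X i \<omega>) + (\<Sum>v\<in>V. \<theta> * w v * g (h v (?X i \<omega>))))"
      using int[of i g] int[of i "\<lambda>s. g (h _ s)"] that by (simp add: Bochner_Integration.integral_sum)
    also have "\<dots> = expectation (\<lambda>\<omega>. ?Q g (?X i \<omega>))"
      by (intro Bochner_Integration.integral_cong) (simp_all add: lazy_average_def average_def sum_distrib_left mult.assoc)
    finally show ?thesis .
  qed
  have Q_bounds: "0 \<le> ?Q g x \<and> ?Q g x \<le> B" if "\<And>x. 0 \<le> g x" "\<And>x. g x \<le> B" for g :: "'b \<Rightarrow> real" and x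
  proof
    have "0 \<le> average V w h g x" and le: "average V w h g x \<le> B"
      using average_iter_bounds[where F = g and B = B and h = h and j = 1] that by auto
    then show "0 \<le> ?Q g x" using \<theta> that by (simp add: lazy_average_def)
    have "?Q g x \<le> (1 - \<theta>) * B + \<theta> * B"
      unfolding lazy_average_def using \<theta> that le by (intro add_mono mult_left_mono) auto
    then show "?Q g x \<le> B" by (simp add: algebra_simps)
  qed
  have "expectation (\<lambda>\<omega>. g (?X i \<omega>)) = (?Q ^^ i) g x"
    if "i \<le> n" "\<And>x. 0 \<le> g x" "\<And>x. g x \<le> B" for i g
    using that
  proof (induction i arbitrary: g)
    case 0
    then show ?case by (simp add: prob_space)
  next
    case (Suc i)
    have "expectation (\<lambda>\<omega>. g (?X (Suc i) \<omega>)) = expectation (\<lambda>\<omega>. ?Q g (?X i \<omega>))"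
      using Suc.prems by (intro step) auto
    also have "\<dots> = (?Q ^^ i) (?Q g) x"
      using Suc.prems Q_bounds[of g] by (intro Suc.IH) auto
    finally show ?case by (simp only: funpow_Suc_right o_apply)
  qed
  from this[of n f] show ?thesis using f by simp
qed


section \<open>Independence of the rings in disjoint time cells\<close>

context zero_range_process begin

definition cell_count :: "real \<Rightarrow> nat \<Rightarrow> int \<Rightarrow> 'a \<Rightarrow> nat" where
  "cell_count h i z \<omega> = N z (real (Suc i) * h) \<omega> - N z (real i * h) \<omega>"

abbreviation clock_events :: "int \<Rightarrow> 'a set set" where
  "clock_events z \<equiv> sets (vimage_algebra (space M) (\<lambda>\<omega>. \<lambda>t\<in>{0..}. N z t \<omega>) (\<Pi>\<^sub>M t\<in>{0..}. count_space UNIV))"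

lemma clock_measurable: "0 \<le> t \<Longrightarrow> random_variable (count_space UNIV) (N z t)"
  using poisson[of z] by (simp add: poisson_process_def)

lemma clock_events_sub: "clock_events z \<subseteq> events"
  by (rule sets_image_in_sets) (auto intro!: measurable_restrict clock_measurable)

lemma cell_count_clock_event:
  assumes "0 \<le> h"
  shows "cell_count h i z -` S \<inter> space M \<in> clock_events z"
proof -
  let ?P = "\<Pi>\<^sub>M t\<in>{0::real..}. count_space (UNIV :: nat set)"
  let ?a = "real i * h" and ?b = "real (Suc i) * h"
  have ab: "0 \<le> ?a" "0 \<le> ?b" using assms by auto
  have coord: "(\<lambda>f. f t) \<in> measurable ?P (count_space UNIV)" if "0 \<le> t" for t
    using that by (intro measurable_component_singleton) auto
  have "(\<lambda>f. f b - f a) \<in> measurable ?P (count_space UNIV)" if "0 \<le> a" "0 \<le> b" for a b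
  proof (rule measurable_compose_countable[where f = "\<lambda>k f. f b - k" and g = "\<lambda>f. f a"])
    show "(\<lambda>f. f b - k) \<in> measurable ?P (count_space UNIV)" for k
      by (rule measurable_compose[OF coord[OF that(2)]]) simp
  qed (rule coord[OF that(1)])
  from this[OF ab] have "(\<lambda>f. f ?b - f ?a) -` S \<inter> space ?P \<in> sets ?P"
    by (rule measurable_sets) simp
  then have "(\<lambda>\<omega>. \<lambda>t\<in>{0..}. N z t \<omega>) -` ((\<lambda>f. f ?b - f ?a) -` S \<inter> space ?P) \<inter> space M \<in> clock_events z"
    by (rule in_vimage_algebra)
  also have "(\<lambda>\<omega>. \<lambda>t\<in>{0..}. N z t \<omega>) -` ((\<lambda>f. f ?b - f ?a) -` S \<inter> space ?P) \<inter> space M =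
      cell_count h i z -` S \<inter> space M"
    using ab by (auto simp: cell_count_def space_PiM)
  finally show ?thesis .
qed

lemma cell_count_measurable: "0 \<le> h \<Longrightarrow> random_variable (count_space UNIV) (cell_count h i z)"
  by (rule measurableI) (auto intro: subsetD[OF clock_events_sub[of z]] cell_count_clock_event)

lemma cell_count_prob:
  assumes "0 < h" "0 < p z"
  shows "prob {\<omega>\<in>space M. cell_count h i z \<omega> = k} = (p z * h) ^ k / fact k * exp (- (p z * h))"
proof -
  have "distr M (count_space UNIV) (cell_count h i z) =
      measure_pmf (poisson_pmf (p z * (real (Suc i) * h - real i * h)))"
    using poisson[of z] assms unfolding poisson_process_def cell_count_def[abs_def] by simp
  also have "real (Suc i) * h - real i * h = h" by (simp add: algebra_simps)
  finally have "measure (distr M (count_space UNIV) (cell_count h i z)) {k} =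
      measure (measure_pmf (poisson_pmf (p z * h))) {k}" by simp
  moreover have "measure (distr M (count_space UNIV) (cell_count h i z)) {k} = prob {\<omega>\<in>space M. cell_count h i z \<omega> = k}"
    using cell_count_measurable[of h i z] assms
    by (subst measure_distr) (auto simp: vimage_def Int_def conj_commute)
  ultimately show ?thesis using assms by (simp add: measure_pmf_single)
qed

text \<open>Two sources of independence are combined: that of the increments of one clock over disjoint cells,
  and that of different clocks.\<close>
lemma indep_cell_counts:
  assumes "finite E" "0 < h"
  shows "indep_vars (\<lambda>_. count_space UNIV) (\<lambda>(i, z). cell_count h i z) ({..<n} \<times> E)"
proof (cases "n = 0 \<or> E = {}")
  case True
  then have empty: "{..<n} \<times> E = {}" by auto
  show ?thesis unfolding empty by (simp add: indep_vars_def indep_sets_def)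
next
  case False
  define F where "F = (\<lambda>(i, z). {cell_count h i z -` A \<inter> space M | A. A \<in> sets (count_space UNIV)})"
  have F_clock: "A \<in> clock_events z" if "A \<in> F (i, z)" for A i z
    using that cell_count_clock_event[of h i z] assms by (auto simp: F_def)
  have "indep_sets F ({..<n} \<times> E)"
  proof (subst indep_sets_finite)
    show "\<forall>A\<in>Pi ({..<n} \<times> E) F. prob (\<Inter>j\<in>{..<n} \<times> E. A j) = (\<Prod>j\<in>{..<n} \<times> E. prob (A j))"
    proof
      fix A assume A: "A \<in> Pi ({..<n} \<times> E) F"
      define B where "B z = (\<Inter>i<n. A (i, z))" for z
      have B: "B z \<in> clock_events z" if "z \<in> E" for z
        unfolding B_def using A F_clock that False by (intro sets.finite_INT) auto
      have single: "prob (B z) = (\<Prod>i<n. prob (A (i, z)))" if "z \<in> E" for z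
      proof -
        have "indep_vars (\<lambda>_. count_space UNIV) (\<lambda>i \<omega>. N z (real (Suc i) * h) \<omega> - N z (real i * h) \<omega>) {..<n}"
          using poisson[of z] assms(2) unfolding poisson_process_def
          by (elim conjE allE[of _ n] allE[of _ "\<lambda>i. real i * h"]) (auto simp: strict_mono_def)
        then have "indep_sets (\<lambda>i. F (i, z)) {..<n}"
          unfolding indep_vars_def2 F_def cell_count_def[abs_def] by simp
        then show ?thesis
          unfolding B_def by (rule indep_setsD) (use A that False in auto)
      qed
      have "prob (\<Inter>j\<in>{..<n} \<times> E. A j) = prob (\<Inter>z\<in>E. B z)"
        unfolding B_def using False by (intro arg_cong[where f = prob]) auto
      also have "(\<Inter>z\<in>E. B z) = (\<Inter>j\<in>Some ` E. case_option {} B j)" by simp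
      also have "prob \<dots> = (\<Prod>j\<in>Some ` E. prob (case_option {} B j))"
        using indep by (rule indep_setsD) (use B assms False in auto)
      also have "\<dots> = (\<Prod>z\<in>E. \<Prod>i<n. prob (A (i, z)))"
        by (simp add: prod.reindex single)
      also have "\<dots> = (\<Prod>j\<in>{..<n} \<times> E. prob (A j))"
        by (subst prod.swap) (simp add: prod.cartesian_product)
      finally show "prob (\<Inter>j\<in>{..<n} \<times> E. A j) = (\<Prod>j\<in>{..<n} \<times> E. prob (A j))" .
    qed
    show "F j \<subseteq> events" if "j \<in> {..<n} \<times> E" for j
      using F_clock clock_events_sub by (cases j) blast
    show "space M \<in> F j" if "j \<in> {..<n} \<times> E" for j
      by (auto simp: F_def split: prod.splits intro!: exI[of _ UNIV])
  qed (use assms False in auto)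
  then show ?thesis
    unfolding indep_vars_def2 F_def using cell_count_measurable assms
    by (auto simp: case_prod_unfold)
qed

end


locale queue_window = zero_range_process M p N \<eta> + tandem_queue y m p
  for M :: "'a measure" and p :: "int \<Rightarrow> real" and N \<eta> y m
begin

definition lone_ring :: "real \<Rightarrow> nat \<Rightarrow> int \<Rightarrow> 'a \<Rightarrow> bool" where
  "lone_ring h i v \<omega> \<longleftrightarrow> (\<forall>u\<in>E. cell_count h i u \<omega> = of_bool (u = v))"

text \<open>Cells with several rings get the mark \<open>None\<close>, like silent ones. The law of the marks is then an exact
  multiple of the rates \<open>p v\<close>, so that the chain has the tandem equilibrium as an exactly invariant law,
  whatever the length of the cells is.\<close>
definition cell_ring :: "real \<Rightarrow> nat \<Rightarrow> 'a \<Rightarrow> int option" where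
  "cell_ring h i \<omega> = (if \<exists>v\<in>E. lone_ring h i v \<omega> then Some (THE v. v \<in> E \<and> lone_ring h i v \<omega>) else None)"

definition silent :: "real \<Rightarrow> nat \<Rightarrow> 'a \<Rightarrow> bool" where
  "silent h i \<omega> \<longleftrightarrow> (\<forall>u\<in>E. cell_count h i u \<omega> = 0)"

lemma cell_ring_Some:
  assumes "v \<in> E"
  shows "cell_ring h i \<omega> = Some v \<longleftrightarrow> lone_ring h i v \<omega>"
proof -
  have unique: "v = v'" if "v \<in> E" "v' \<in> E" "lone_ring h i v \<omega>" "lone_ring h i v' \<omega>" for v v'
  proof -
    have *: "cell_count h i v \<omega> = of_bool (v = v)" "cell_count h i v \<omega> = of_bool (v = v')"
      using that unfolding lone_ring_def by blast+
    have "of_bool (v = v') = (1 :: nat)" unfolding *(2)[symmetric] *(1) by (simp only: simp_thms of_bool_eq)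
    then show ?thesis by (cases "v = v'") simp_all
  qed
  show ?thesis
  proof
    assume "cell_ring h i \<omega> = Some v"
    then obtain v' where v': "v' \<in> E" "lone_ring h i v' \<omega>" and "v = (THE v. v \<in> E \<and> lone_ring h i v \<omega>)"
      by (auto simp: cell_ring_def split: if_splits)
    moreover have "(THE v. v \<in> E \<and> lone_ring h i v \<omega>) = v'"
      using v' unique by blast
    ultimately show "lone_ring h i v \<omega>" by simp
  next
    assume "lone_ring h i v \<omega>"
    moreover from this have "(THE v. v \<in> E \<and> lone_ring h i v \<omega>) = v"
      using assms unique by blast
    ultimately show "cell_ring h i \<omega> = Some v"
      using assms by (auto simp: cell_ring_def)
  qed
qed

lemma cell_ring_range: "cell_ring h i \<omega> \<in> insert None (Some ` E)"
proof (cases "cell_ring h i \<omega>")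
  case (Some v)
  then obtain v' where "v' \<in> E" "lone_ring h i v' \<omega>" by (auto simp: cell_ring_def split: if_splits)
  then have "cell_ring h i \<omega> = Some v'" by (simp add: cell_ring_Some)
  then show ?thesis using \<open>v' \<in> E\<close> by simp
qed simp

lemma indep_cell_rings:
  assumes "0 < h"
  shows "indep_vars (\<lambda>_. count_space UNIV) (cell_ring h) {..<n}"
proof -
  define decode :: "nat \<Rightarrow> (nat \<times> int \<Rightarrow> nat) \<Rightarrow> int option" where
    "decode i r = (let lone = (\<lambda>v. \<forall>u\<in>E. r (i, u) = of_bool (u = v)) in
      if \<exists>v\<in>E. lone v then Some (THE v. v \<in> E \<and> lone v) else None)" for i r
  let ?K = "\<lambda>i :: nat. {i} \<times> E"
  have "indep_vars (\<lambda>i. PiM (?K i) (\<lambda>_. count_space UNIV))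
      (\<lambda>i \<omega>. restrict (\<lambda>j. (case j of (i, z) \<Rightarrow> cell_count h i z) \<omega>) (?K i)) {..<n}"
    using indep_cell_counts[of E h n] assms
    by (intro indep_vars_restrict[where I = "{..<n} \<times> E"]) (auto simp: disjoint_family_on_def)
  then have "indep_vars (\<lambda>_. count_space UNIV)
      (\<lambda>i \<omega>. decode i (restrict (\<lambda>j. (case j of (i, z) \<Rightarrow> cell_count h i z) \<omega>) (?K i))) {..<n}"
  proof (rule indep_vars_compose2)
    fix i
    have "PiM (?K i) (\<lambda>_. count_space UNIV) = count_space (PiE (?K i) (\<lambda>_. UNIV :: nat set))"
      by (intro count_space_PiM_finite) auto
    then show "decode i \<in> measurable (PiM (?K i) (\<lambda>_. count_space UNIV)) (count_space UNIV)" by simp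
  qed
  moreover have "decode i (restrict (\<lambda>j. (case j of (i, z) \<Rightarrow> cell_count h i z) \<omega>) (?K i)) = cell_ring h i \<omega>" for i \<omega>
  proof -
    have "(\<forall>u\<in>E. restrict (\<lambda>j. (case j of (i, z) \<Rightarrow> cell_count h i z) \<omega>) (?K i) (i, u) = of_bool (u = v)) \<longleftrightarrow>
      lone_ring h i v \<omega>" for v
      by (simp add: lone_ring_def)
    then show ?thesis by (simp only: decode_def cell_ring_def Let_def)
  qed
  ultimately show ?thesis by simp
qed

lemma pattern_prob:
  assumes "0 < h"
  shows "{\<omega>\<in>space M. \<forall>u\<in>E. cell_count h i u \<omega> = k u} \<in> events"
    "prob {\<omega>\<in>space M. \<forall>u\<in>E. cell_count h i u \<omega> = k u} =
      (\<Prod>u\<in>E. (p u * h) ^ k u / fact (k u) * exp (- (p u * h)))"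
proof -
  have ev: "{\<omega>\<in>space M. cell_count h i u \<omega> = k u} \<in> events" for u
    using measurable_sets[OF cell_count_measurable, of h "{k u}" i u] assms
    by (simp add: vimage_def Int_def conj_commute)
  have y: "y \<in> E" using nonempty by simp
  have eq: "{\<omega>\<in>space M. \<forall>u\<in>E. cell_count h i u \<omega> = k u} = (\<Inter>u\<in>E. {\<omega>\<in>space M. cell_count h i u \<omega> = k u})"
    unfolding set_eq_iff using y by blast
  show "{\<omega>\<in>space M. \<forall>u\<in>E. cell_count h i u \<omega> = k u} \<in> events"
    unfolding eq by (intro sets.finite_INT ev) (use nonempty in auto)
  have "prob (\<Inter>j\<in>{i} \<times> E. (case j of (i, z) \<Rightarrow> cell_count h i z) -` {k (snd j)} \<inter> space M) =
      (\<Prod>j\<in>{i} \<times> E. prob ((case j of (i, z) \<Rightarrow> cell_count h i z) -` {k (snd j)} \<inter> space M))"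
    using indep_cell_counts[of E h "Suc i"] assms nonempty by (intro indep_varsD) auto
  also have "(\<Inter>j\<in>{i} \<times> E. (case j of (i, z) \<Rightarrow> cell_count h i z) -` {k (snd j)} \<inter> space M) =
      {\<omega>\<in>space M. \<forall>u\<in>E. cell_count h i u \<omega> = k u}"
    using nonempty by auto
  also have "{i} \<times> E = Pair i ` E" by auto
  also have "(\<Prod>j\<in>Pair i ` E. prob ((case j of (i, z) \<Rightarrow> cell_count h i z) -` {k (snd j)} \<inter> space M)) =
      (\<Prod>u\<in>E. prob {\<omega>\<in>space M. cell_count h i u \<omega> = k u})"
    by (subst prod.reindex) (auto simp: inj_on_def vimage_def Int_def conj_commute)
  also have "\<dots> = (\<Prod>u\<in>E. (p u * h) ^ k u / fact (k u) * exp (- (p u * h)))"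
    by (intro prod.cong refl cell_count_prob rate_pos assms)
  finally show "prob {\<omega>\<in>space M. \<forall>u\<in>E. cell_count h i u \<omega> = k u} =
      (\<Prod>u\<in>E. (p u * h) ^ k u / fact (k u) * exp (- (p u * h)))" .
qed

lemma prod_exp_rates: "(\<Prod>u\<in>E. exp (- (p u * h))) = exp (- (total_rate * h))"
  by (simp add: exp_sum[symmetric] total_rate_def sum_distrib_right sum_negf)

lemma silent_prob:
  assumes "0 < h"
  shows "{\<omega>\<in>space M. silent h i \<omega>} \<in> events" "prob {\<omega>\<in>space M. silent h i \<omega>} = exp (- (total_rate * h))"
  using pattern_prob[OF assms, of i "\<lambda>_. 0"] by (simp_all add: silent_def prod_exp_rates)

lemma lone_ring_prob:
  assumes "0 < h" "v \<in> E"
  shows "{\<omega>\<in>space M. lone_ring h i v \<omega>} \<in> events"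
    "prob {\<omega>\<in>space M. lone_ring h i v \<omega>} = p v * h * exp (- (total_rate * h))"
proof -
  show "{\<omega>\<in>space M. lone_ring h i v \<omega>} \<in> events"
    using pattern_prob(1)[OF assms(1), of i "\<lambda>u. of_bool (u = v)"] by (simp add: lone_ring_def)
  have "prob {\<omega>\<in>space M. lone_ring h i v \<omega>} =
      (\<Prod>u\<in>E. (p u * h) ^ of_bool (u = v) / fact (of_bool (u = v)) * exp (- (p u * h)))"
    unfolding lone_ring_def by (rule pattern_prob(2)[OF assms(1)])
  also have "\<dots> = (\<Prod>u\<in>E. (if u = v then p u * h else 1) * exp (- (p u * h)))"
    by (intro prod.cong) auto
  also have "\<dots> = (\<Prod>u\<in>E. if u = v then p u * h else 1) * exp (- (total_rate * h))"
    by (simp only: prod.distrib prod_exp_rates)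
  also have "(\<Prod>u\<in>E. if u = v then p u * h else 1) = p v * h"
    using assms(2) by simp
  finally show "prob {\<omega>\<in>space M. lone_ring h i v \<omega>} = p v * h * exp (- (total_rate * h))" .
qed

definition ring_prob :: "real \<Rightarrow> real" where
  "ring_prob h = total_rate * h * exp (- (total_rate * h))"

definition crowded :: "real \<Rightarrow> nat \<Rightarrow> 'a \<Rightarrow> bool" where
  "crowded h i \<omega> \<longleftrightarrow> \<not> silent h i \<omega> \<and> (\<forall>v\<in>E. \<not> lone_ring h i v \<omega>)"

text \<open>With \<open>a = total_rate * h\<close>, at most one ring has probability \<open>exp (- a) * (1 + a)\<close>, which is at least
  \<open>(1 - a) * (1 + a)\<close>.\<close>
lemma crowded_prob:
  assumes "0 < h"
  shows "{\<omega>\<in>space M. crowded h i \<omega>} \<in> events"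
    "prob {\<omega>\<in>space M. crowded h i \<omega>} \<le> (total_rate * h)\<^sup>2"
proof -
  let ?s = "{\<omega>\<in>space M. silent h i \<omega>}" and ?l = "\<lambda>v. {\<omega>\<in>space M. lone_ring h i v \<omega>}"
  have eq: "{\<omega>\<in>space M. crowded h i \<omega>} = space M - (?s \<union> (\<Union>v\<in>E. ?l v))"
    by (auto simp: crowded_def)
  have ev: "?s \<in> events" "(\<Union>v\<in>E. ?l v) \<in> events"
    using silent_prob lone_ring_prob assms by auto
  show "{\<omega>\<in>space M. crowded h i \<omega>} \<in> events" unfolding eq using ev by auto
  have "prob (\<Union>v\<in>E. ?l v) = (\<Sum>v\<in>E. prob (?l v))"
  proof (rule finite_measure_finite_Union)
    show "disjoint_family_on ?l E"
    proof (unfold disjoint_family_on_def, intro ballI impI)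
      fix u v assume uv: "u \<in> E" "v \<in> E" "u \<noteq> v"
      have False if "lone_ring h i u \<omega>" "lone_ring h i v \<omega>" for \<omega>
        using that uv(3) cell_ring_Some[OF uv(1), of h i \<omega>] cell_ring_Some[OF uv(2), of h i \<omega>] by simp
      then show "?l u \<inter> ?l v = {}" by blast
    qed
  qed (use lone_ring_prob assms in auto)
  also have "\<dots> = ring_prob h"
    using assms by (simp add: lone_ring_prob ring_prob_def total_rate_def sum_distrib_right)
  finally have lone: "prob (\<Union>v\<in>E. ?l v) = ring_prob h" .
  have disj: "?s \<inter> (\<Union>v\<in>E. ?l v) = {}"
    by (auto simp: silent_def lone_ring_def)
  have "prob {\<omega>\<in>space M. crowded h i \<omega>} = 1 - prob (?s \<union> (\<Union>v\<in>E. ?l v))"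
    unfolding eq using ev by (intro prob_compl) auto
  also have "\<dots> = 1 - exp (- (total_rate * h)) * (1 + total_rate * h)"
    using finite_measure_Union[OF ev disj] assms by (simp add: silent_prob lone ring_prob_def algebra_simps)
  also have "\<dots> \<le> 1 - (1 - total_rate * h) * (1 + total_rate * h)"
    using exp_ge_add_one_self[of "- (total_rate * h)"] total_rate_pos assms
    by (intro diff_left_mono mult_right_mono) auto
  also have "\<dots> = (total_rate * h)\<^sup>2" by (simp add: algebra_simps power2_eq_square)
  finally show "prob {\<omega>\<in>space M. crowded h i \<omega>} \<le> (total_rate * h)\<^sup>2" .
qed

end


section \<open>Domination of the zero-range process by the tandem of queues\<close>

text \<open>The single-site space is discrete.\<close>
lemma cylinder_continuous:
  assumes "cylinder f"
  shows "continuous_on UNIV f"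
proof -
  obtain J where J: "finite J" "\<And>\<eta> \<xi>. (\<forall>x\<in>J. \<eta> x = \<xi> x) \<Longrightarrow> f \<eta> = f \<xi>"
    using assms unfolding cylinder_def by blast
  have "open {\<xi>. \<forall>x\<in>J. \<xi> x = \<eta> x}" for \<eta> :: config
  proof -
    have "{\<xi>. \<forall>x\<in>J. \<xi> x = \<eta> x} = (\<Inter>x\<in>J. (\<lambda>\<xi>. \<xi> x) -` {\<eta> x})" by auto
    also have "open \<dots>"
      using J(1) by (intro open_INT ballI open_vimage discrete_topology_class.open_discrete) simp_all
    finally show ?thesis .
  qed
  moreover have "f -` B = (\<Union>\<eta>\<in>f -` B. {\<xi>. \<forall>x\<in>J. \<xi> x = \<eta> x})" for B
    using J(2) by fastforce
  ultimately show ?thesis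
    by (subst continuous_on_open_vimage) (metis (no_types, lifting) Int_UNIV_right open_UN open_UNIV)+
qed

lemma cylinder_measurable: "cylinder f \<Longrightarrow> f \<in> borel_measurable borel"
  by (intro borel_measurable_continuous_onI cylinder_continuous)

lemma open_some_site_exceeds: "open {\<xi>::config. \<exists>w\<in>A. x w < \<xi> w}"
proof -
  have "{\<xi>::config. \<exists>w\<in>A. x w < \<xi> w} = (\<Union>w\<in>A. (\<lambda>\<xi>. \<xi> w) -` {x w<..})" by auto
  then show ?thesis by (auto intro!: open_UN open_vimage simp: discrete_topology_class.open_discrete)
qed

lemma exponential_decay: "0 < c \<Longrightarrow> ((\<lambda>t. C * exp (- (c * t))) \<longlongrightarrow> 0) at_top"
  for c C :: real
  by real_asymp

lemma mass_cong: "(\<forall>z\<in>W. x z = x' z) \<Longrightarrow> mass W x = mass W x'"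
  by (simp add: mass_def)

context queue_window begin

lemma ring_prob_bounds:
  assumes "0 < h"
  shows "0 \<le> ring_prob h" "ring_prob h \<le> 1"
proof -
  let ?x = "total_rate * h"
  have x: "0 < ?x" using assms total_rate_pos by simp
  then show "0 \<le> ring_prob h" by (simp add: ring_prob_def)
  have "?x \<le> exp ?x" using exp_ge_add_one_self[of ?x] by linarith
  then show "ring_prob h \<le> 1" by (simp add: ring_prob_def exp_minus field_simps)
qed

text \<open>The discrete tandem shares the clocks of the zero-range process, which makes a pathwise comparison
  possible.\<close>
definition envelope :: "real \<Rightarrow> config \<Rightarrow> nat \<Rightarrow> 'a \<Rightarrow> config" where
  "envelope h x i \<omega> = run (hop W) x (\<lambda>j. cell_ring h j \<omega>) i"

lemma envelope_measurable:
  assumes "0 < h"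
  shows "random_variable (count_space UNIV) (envelope h x i)"
  unfolding envelope_def[abs_def]
  by (rule measurable_run) (use indep_cell_rings[OF assms, of i] in \<open>auto simp: indep_vars_def\<close>)

lemma expectation_envelope:
  assumes "0 < h" "\<And>x. 0 \<le> f x" "\<And>x. f x \<le> B"
  shows "expectation (\<lambda>\<omega>. f (envelope h x n \<omega>)) =
    (lazy_average E (\<lambda>v. p v / total_rate) (hop W) (ring_prob h) ^^ n) f x"
  unfolding envelope_def
proof (rule expectation_run)
  show "prob {\<omega> \<in> space M. cell_ring h i \<omega> = Some v} = ring_prob h * (p v / total_rate)" if "v \<in> E" for i v
    using lone_ring_prob[OF assms(1) that, of i] that total_rate_pos by (simp add: cell_ring_Some ring_prob_def)
qed (use assms ring_prob_bounds indep_cell_rings cell_ring_range random_updates_axioms in auto)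

lemma AE_regular:
  "AE \<omega> in M. zero_range_path (\<lambda>x t. N x t \<omega>) (\<lambda>t. \<eta> t \<omega>) \<and>
     (\<forall>z. mono_on {0..} (\<lambda>t. N z t \<omega>) \<and> (\<forall>t\<ge>0. continuous (at_right t) (\<lambda>s. N z s \<omega>)))"
proof -
  have "AE \<omega> in M. mono_on {0..} (\<lambda>t. N z t \<omega>) \<and> (\<forall>t\<ge>0. continuous (at_right t) (\<lambda>s. N z s \<omega>))" for z
    using poisson[of z] unfolding poisson_process_def by auto
  then have "AE \<omega> in M. \<forall>z. mono_on {0..} (\<lambda>t. N z t \<omega>) \<and> (\<forall>t\<ge>0. continuous (at_right t) (\<lambda>s. N z s \<omega>))"
    by (simp add: AE_all_countable)
  with dynamics show ?thesis by (rule AE_conjI)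
qed

text \<open>In a cell without rings the process does not change in the window; in a cell with one ring it makes
  at most the same hop as the tandem, whose source always has a particle to offer, and hops preserve
  the order.\<close>
lemma dominated_by_envelope:
  assumes path: "zero_range_path (\<lambda>x t. N x t \<omega>) (\<lambda>t. \<eta> t \<omega>)"
    and mono: "\<And>z. mono_on {0..} (\<lambda>t. N z t \<omega>)"
    and right: "\<And>z t. 0 \<le> t \<Longrightarrow> continuous (at_right t) (\<lambda>s. N z s \<omega>)"
    and start: "\<And>w. w \<in> W \<Longrightarrow> \<eta> 0 \<omega> w \<le> x w"
    and calm: "\<And>i. i < n \<Longrightarrow> \<not> crowded h i \<omega>"
    and "0 < h"
  shows "i \<le> n \<Longrightarrow> w \<in> W \<Longrightarrow> \<eta> (real i * h) \<omega> w \<le> envelope h x i \<omega> w"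
proof (induction i arbitrary: w)
  case 0
  then show ?case by (simp add: envelope_def start)
next
  case (Suc i)
  let ?s = "real i * h" and ?t = "real (Suc i) * h"
  have st: "0 \<le> ?s" "?s < ?t" using \<open>0 < h\<close> by auto
  have IH: "\<eta> ?s \<omega> w \<le> envelope h x i \<omega> w" if "w \<in> W" for w using Suc.IH[OF _ that] Suc.prems by simp
  have N_le: "N z ?s \<omega> \<le> N z ?t \<omega>" for z
    using mono_onD[OF mono[of z], of ?s ?t] st by auto
  show ?case
  proof (cases "cell_ring h i \<omega>")
    case None
    have "\<not> lone_ring h i v \<omega>" if "v \<in> E" for v
      using None cell_ring_Some[OF that, of h i \<omega>] by simp
    then have "silent h i \<omega>"
      using calm[of i] Suc.prems(1) unfolding crowded_def by auto
    then have same: "N z ?s \<omega> = N z ?t \<omega>" if "z \<in> E" for z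
    proof -
      have "cell_count h i z \<omega> = 0" using \<open>silent h i \<omega>\<close> that unfolding silent_def by blast
      then show ?thesis using N_le[of z] by (simp add: cell_count_def)
    qed
    have "\<eta> ?s \<omega> w = \<eta> ?t \<omega> w"
      by (rule quiet_site_constant[OF path]) (use mono same Suc.prems st in auto)
    then show ?thesis using IH[OF Suc.prems(2)] None by (simp add: envelope_def)
  next
    case (Some v)
    then have v: "v \<in> E" using cell_ring_range[of h i \<omega>] by auto
    then have lone: "cell_count h i u \<omega> = of_bool (u = v)" if "u \<in> E" for u
      using Some that by (simp add: cell_ring_Some lone_ring_def)
    have "\<eta> ?t \<omega> w \<le> hop W v (envelope h x i \<omega>) w"
    proof (rule single_ring_dominated[OF path _ _ v _ _ st])
      show "N v ?t \<omega> = Suc (N v ?s \<omega>)"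
        using lone[OF v] N_le[of v] by (simp add: cell_count_def)
      show "N u ?s \<omega> = N u ?t \<omega>" if "u \<in> E" "u \<noteq> v" for u
        using lone[OF that(1)] N_le[of u] that by (simp add: cell_count_def)
    qed (use mono right IH Suc.prems in auto)
    then show ?thesis using Some by (simp add: envelope_def)
  qed
qed

lemma event_of_open: "0 \<le> t \<Longrightarrow> open U \<Longrightarrow> {\<omega>\<in>space M. \<eta> t \<omega> \<in> U} \<in> events"
  using measurable_sets[OF measurable, of t U] by (simp add: vimage_def Int_def conj_commute)

text \<open>Domination fails only if the process starts above \<open>x\<close> or if some cell contains two rings. The latter
  has probability at most \<open>n * (total_rate * t / n)\<^sup>2\<close>.\<close>
lemma expectation_le_envelope:
  assumes f: "mono f" "\<And>x. 0 \<le> f x" "\<And>x. f x \<le> B"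
    and local: "\<And>\<eta> \<xi>. (\<forall>x\<in>W. \<eta> x = \<xi> x) \<Longrightarrow> f \<eta> = f \<xi>"
    and t: "0 < t" and n: "0 < n"
  shows "expectation (\<lambda>\<omega>. f (\<eta> t \<omega>)) \<le>
    (lazy_average E (\<lambda>v. p v / total_rate) (hop W) (ring_prob (t / n)) ^^ n) f x
    + B * prob {\<omega>\<in>space M. \<exists>w\<in>W. x w < \<eta> 0 \<omega> w} + B * (total_rate * t)\<^sup>2 / real n"
proof -
  define h where "h = t / real n"
  have h: "0 < h" "real n * h = t" using t n by (auto simp: h_def)
  have B: "0 \<le> B" using f(2,3)[of x] by linarith
  let ?high = "{\<omega>\<in>space M. \<exists>w\<in>W. x w < \<eta> 0 \<omega> w}"
  let ?crowd = "\<lambda>i. {\<omega>\<in>space M. crowded h i \<omega>}"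
  have cyl: "cylinder f" unfolding cylinder_def using local by (intro exI[of _ W]) auto
  have high: "?high \<in> events"
    using event_of_open[of 0, OF _ open_some_site_exceeds[of W x]] by simp
  have int\<eta>: "integrable M (\<lambda>\<omega>. f (\<eta> t \<omega>))"
    by (rule integrable_const_bound[where B = B])
      (use f t measurable_compose[OF measurable cylinder_measurable[OF cyl], of t] in auto)
  have intX: "integrable M (\<lambda>\<omega>. f (envelope h x n \<omega>))"
    by (rule integrable_const_bound[where B = B])
      (use f measurable_compose[OF envelope_measurable[OF h(1)], of f borel] in auto)
  have int_ind: "integrable M (indicator A :: 'a \<Rightarrow> real)" if "A \<in> events" for A
    using that by (simp add: emeasure_eq_measure)
  have pointwise: "AE \<omega> in M. f (\<eta> t \<omega>) \<le>
      f (envelope h x n \<omega>) + B * indicator ?high \<omega> + B * (\<Sum>i<n. indicator (?crowd i) \<omega>)"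
    using AE_regular AE_space
  proof eventually_elim
    case (elim \<omega>)
    have nonneg: "0 \<le> B * indicator ?high \<omega>" "0 \<le> B * (\<Sum>i<n. indicator (?crowd i) \<omega>)"
      using B by (auto intro!: mult_nonneg_nonneg sum_nonneg)
    have 0: "0 \<le> f (envelope h x n \<omega>)" and le_B: "f (\<eta> t \<omega>) \<le> B" using f by auto
    consider "\<omega> \<in> ?high" | i where "i < n" "\<omega> \<in> ?crowd i" | "\<omega> \<notin> ?high" "\<forall>i<n. \<omega> \<notin> ?crowd i" by blast
    then show ?case
    proof cases
      case 1
      then have "B * indicator ?high \<omega> = B" by simp
      then show ?thesis using nonneg(2) 0 le_B by linarith
    next
      case (2 i)
      have "1 = (indicator (?crowd i) \<omega> :: real)" using 2 by simp
      also have "\<dots> \<le> (\<Sum>i<n. indicator (?crowd i) \<omega>)"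
        using 2 by (intro member_le_sum) auto
      finally have "B * 1 \<le> B * (\<Sum>i<n. indicator (?crowd i) \<omega>)" by (rule mult_left_mono) (rule B)
      then show ?thesis using nonneg(1) 0 le_B by linarith
    next
      case 3
      have "\<eta> (real n * h) \<omega> w \<le> envelope h x n \<omega> w" if "w \<in> W" for w
        by (rule dominated_by_envelope[of \<omega> x n h n w]) (use elim 3 h that in \<open>auto simp: not_less\<close>)
      then have "(\<lambda>w. if w \<in> W then \<eta> t \<omega> w else 0) \<le> envelope h x n \<omega>"
        by (simp add: le_fun_def h(2))
      then have "f (\<lambda>w. if w \<in> W then \<eta> t \<omega> w else 0) \<le> f (envelope h x n \<omega>)"
        by (rule monoD[OF f(1)])
      moreover have "f (\<lambda>w. if w \<in> W then \<eta> t \<omega> w else 0) = f (\<eta> t \<omega>)" by (rule local) simp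
      ultimately show ?thesis using nonneg by linarith
    qed
  qed
  have "expectation (\<lambda>\<omega>. f (\<eta> t \<omega>)) \<le> expectation (\<lambda>\<omega>.
      f (envelope h x n \<omega>) + B * indicator ?high \<omega> + B * (\<Sum>i<n. indicator (?crowd i) \<omega>))"
    by (intro integral_mono_AE pointwise int\<eta> Bochner_Integration.integrable_add intX integrable_mult_right
      Bochner_Integration.integrable_sum int_ind high crowded_prob(1) h)
  also have "\<dots> = expectation (\<lambda>\<omega>. f (envelope h x n \<omega>)) + B * prob ?high + B * (\<Sum>i<n. prob (?crowd i))"
    using int_ind[OF high] int_ind[OF crowded_prob(1)[OF h(1)]] intX high crowded_prob(1)[OF h(1)]
    by (simp add: Bochner_Integration.integral_sum)
  also have "\<dots> \<le> expectation (\<lambda>\<omega>. f (envelope h x n \<omega>)) + B * prob ?high + B * (\<Sum>i<n. (total_rate * h)\<^sup>2)"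
    using B by (intro add_left_mono mult_left_mono sum_mono crowded_prob h)
  also have "B * (\<Sum>i<n. (total_rate * h)\<^sup>2) = B * (total_rate * t)\<^sup>2 / real n"
    using n by (simp add: h_def power2_eq_square field_simps)
  also have "expectation (\<lambda>\<omega>. f (envelope h x n \<omega>)) =
      (lazy_average E (\<lambda>v. p v / total_rate) (hop W) (ring_prob h) ^^ n) f x"
    by (rule expectation_envelope[OF h(1) f(2,3)])
  finally show ?thesis by (simp only: h_def)
qed

text \<open>As the number \<open>n\<close> of cells grows, the discretisation error disappears, and a bound on the tandem after
  many rings becomes a bound on the process after a long time.\<close>
lemma expectation_le_ring_bound:
  assumes f: "mono f" "\<And>x. 0 \<le> f x" "\<And>x. f x \<le> B"
    and local: "\<And>\<eta> \<xi>. (\<forall>x\<in>W. \<eta> x = \<xi> x) \<Longrightarrow> f \<eta> = f \<xi>"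
    and t: "0 < t" and A: "0 \<le> A"
    and early: "\<And>j. (ring ^^ j) f x \<le> b + A"
    and late: "\<And>j. j \<ge> J \<Longrightarrow> (ring ^^ j) f x \<le> b"
  shows "expectation (\<lambda>\<omega>. f (\<eta> t \<omega>)) \<le>
    b + A * 2 ^ J * exp (- (total_rate * exp (- 1) / 2 * t))
    + B * prob {\<omega>\<in>space M. \<exists>w\<in>W. x w < \<eta> 0 \<omega> w}" (is "?L \<le> ?R")
proof (rule LIMSEQ_le_const)
  let ?a = "total_rate * t"
  show "(\<lambda>n. ?R + B * ?a\<^sup>2 / real n) \<longlonglongrightarrow> ?R"
    using tendsto_add[OF tendsto_const lim_const_over_n] by fastforce
  show "\<exists>N. \<forall>n\<ge>N. ?L \<le> ?R + B * ?a\<^sup>2 / real n"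
  proof (intro exI[of _ "Suc (nat \<lceil>?a\<rceil>)"] allI impI)
    fix n assume n: "Suc (nat \<lceil>?a\<rceil>) \<le> n"
    then have "0 < n" and a_le: "?a \<le> real n" by linarith+
    let ?\<theta> = "ring_prob (t / n)"
    have h: "0 < t / n" using t \<open>0 < n\<close> by simp
    note \<theta> = ring_prob_bounds[OF h]
    have "?a / n \<le> 1" using a_le \<open>0 < n\<close> by simp
    \<comment> \<open>For \<open>n\<close> above \<open>total_rate * t\<close> a cell has exactly one ring with probability at least \<open>exp (- 1)\<close> times its mean
      number of rings, so the lazy chain makes on average at least \<open>exp (- 1) * total_rate * t\<close> updates.\<close>
    then have "?a / n * exp (- 1) \<le> ?a / n * exp (- (?a / n))"
      using total_rate_pos t by (intro mult_left_mono) auto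
    then have "?a / n * exp (- 1) \<le> ?\<theta>" by (simp add: ring_prob_def)
    then have "?a * exp (- 1) \<le> n * ?\<theta>" using \<open>0 < n\<close> by (simp add: field_simps)
    then have rate: "- (n * (?\<theta> / 2)) \<le> - (total_rate * exp (- 1) / 2 * t)" by (simp add: field_simps)
    have "(1 - ?\<theta> / 2) ^ n \<le> exp (- (?\<theta> / 2)) ^ n"
      using exp_ge_add_one_self[of "- (?\<theta> / 2)"] \<theta> by (intro power_mono) auto
    also have "\<dots> = exp (- (n * (?\<theta> / 2)))" by (simp add: exp_of_nat_mult[symmetric])
    also have "\<dots> \<le> exp (- (total_rate * exp (- 1) / 2 * t))" using rate by simp
    finally have decay: "(1 - ?\<theta> / 2) ^ n \<le> exp (- (total_rate * exp (- 1) / 2 * t))" .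
    have "(lazy_average E (\<lambda>v. p v / total_rate) (hop W) ?\<theta> ^^ n) f x \<le> b + A * 2 ^ J * (1 - ?\<theta> / 2) ^ n"
      using \<theta> A early late by (rule lazy_iterate_le)
    also have "\<dots> \<le> b + A * 2 ^ J * exp (- (total_rate * exp (- 1) / 2 * t))"
      using A by (intro add_left_mono mult_left_mono decay) auto
    finally show "?L \<le> ?R + B * ?a\<^sup>2 / real n"
      using expectation_le_envelope[OF f local t \<open>0 < n\<close>, of x] by linarith
  qed
qed

lemma high_start_vanishes: "(\<lambda>D. prob {\<omega>\<in>space M. \<exists>w\<in>W. D < \<eta> 0 \<omega> w}) \<longlonglongrightarrow> 0"
proof -
  let ?A = "\<lambda>D. {\<omega>\<in>space M. \<exists>w\<in>W. D < \<eta> 0 \<omega> w}"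
  have "(\<lambda>D. prob (?A D)) \<longlonglongrightarrow> prob (\<Inter>D. ?A D)"
  proof (rule finite_Lim_measure_decseq)
    show "range ?A \<subseteq> events"
      using event_of_open[of 0, OF _ open_some_site_exceeds[of W "\<lambda>_. _"]] by auto
    show "decseq ?A" by (auto simp: decseq_def intro: le_less_trans)
  qed
  also have "(\<Inter>D. ?A D) = {}"
  proof -
    have "\<omega> \<notin> ?A (Max ((\<lambda>w. \<eta> 0 \<omega> w) ` W))" for \<omega>
      using nonempty by (auto simp: not_less)
    then show ?thesis by blast
  qed
  finally show ?thesis by simp
qed

text \<open>The random initial configuration is replaced by a deterministic one, equal to \<open>D\<close> on the window, at the
  price of the small probability that some site holds more than \<open>D\<close> particles initially.\<close>
theorem eventually_expectation_le_equilibrium: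
  fixes B :: real
  assumes f: "mono f" "\<And>x. 0 \<le> f x" "\<And>x. f x \<le> B"
    and local: "\<And>\<eta> \<xi>. (\<forall>x\<in>W. \<eta> x = \<xi> x) \<Longrightarrow> f \<eta> = f \<xi>"
    and "0 < \<epsilon>"
  shows "\<forall>\<^sub>F t in at_top. expectation (\<lambda>\<omega>. f (\<eta> t \<omega>)) \<le> measure_pmf.expectation equilibrium f + \<epsilon>"
proof -
  have B: "0 \<le> B" using f(2,3)[of "\<lambda>_. 0"] by linarith
  have small: "\<exists>n. \<forall>k\<ge>n. B * a k \<le> \<epsilon> / 3" if "a \<longlonglongrightarrow> 0" for a :: "nat \<Rightarrow> real"
  proof -
    have "(\<lambda>k. B * a k) \<longlonglongrightarrow> B * 0" by (intro tendsto_intros that)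
    then have "\<forall>\<^sub>F k in sequentially. B * a k < \<epsilon> / 3" by (rule order_tendstoD) (use \<open>0 < \<epsilon>\<close> in simp)
    then show ?thesis by (auto simp: eventually_sequentially intro: less_imp_le)
  qed
  obtain D where D: "B * prob {\<omega>\<in>space M. \<exists>w\<in>W. D < \<eta> 0 \<omega> w} \<le> \<epsilon> / 3"
    using small[OF high_start_vanishes] by blast
  define x where "x u = (if u \<in> W then D else 0)" for u
  have "discrepancy x \<longlonglongrightarrow> 0" by (rule discrepancy_vanishes) (simp add: x_def del: greaterThanAtMost_iff)
  then obtain J where J: "\<And>j. j \<ge> J \<Longrightarrow> B * discrepancy x j \<le> \<epsilon> / 3" using small by blast
  let ?b = "measure_pmf.expectation equilibrium f + \<epsilon> / 3"
  have late: "(ring ^^ j) f x \<le> ?b" if "j \<ge> J" for j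
    using ring_iter_le_equilibrium[OF f, of x j] J[OF that] by (simp add: x_def del: greaterThanAtMost_iff)
  have early: "(ring ^^ j) f x \<le> ?b + B" for j
  proof -
    have "(ring ^^ j) f x \<le> B" by (rule average_iter_bounds f)+
    moreover have "0 \<le> measure_pmf.expectation equilibrium f" by (intro integral_nonneg_AE AE_I2 f)
    ultimately show ?thesis using \<open>0 < \<epsilon>\<close> by simp
  qed
  let ?c = "total_rate * exp (- 1) / 2"
  have "0 < ?c" using total_rate_pos by simp
  then have "((\<lambda>t. B * 2 ^ J * exp (- (?c * t))) \<longlongrightarrow> 0) at_top"
    by (rule exponential_decay)
  then have "\<forall>\<^sub>F t in at_top. B * 2 ^ J * exp (- (?c * t)) < \<epsilon> / 3"
    by (rule order_tendstoD) (use \<open>0 < \<epsilon>\<close> in simp)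
  with eventually_gt_at_top[of 0] show ?thesis
  proof eventually_elim
    case (elim t)
    have "expectation (\<lambda>\<omega>. f (\<eta> t \<omega>)) \<le> ?b + B * 2 ^ J * exp (- (?c * t))
        + B * prob {\<omega>\<in>space M. \<exists>w\<in>W. x w < \<eta> 0 \<omega> w}"
      by (rule expectation_le_ring_bound[OF f local elim(1) B early late])
    also have "{\<omega>\<in>space M. \<exists>w\<in>W. x w < \<eta> 0 \<omega> w} = {\<omega>\<in>space M. \<exists>w\<in>W. D < \<eta> 0 \<omega> w}"
      by (auto simp: x_def)
    finally show ?case using elim(2) D by linarith
  qed
qed

theorem uniform_mass_tail:
  assumes "0 < \<epsilon>"
  shows "\<exists>K. \<forall>t>0. prob {\<omega>\<in>space M. K < mass W (\<eta> t \<omega>)} \<le> \<epsilon>"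
proof -
  have small: "\<exists>k. a k \<le> \<epsilon> / 2" if "a \<longlonglongrightarrow> 0" for a :: "nat \<Rightarrow> real"
  proof -
    have "\<forall>\<^sub>F k in sequentially. a k < \<epsilon> / 2" using that by (rule order_tendstoD) (use assms in simp)
    then show ?thesis by (auto simp: eventually_sequentially intro: less_imp_le)
  qed
  obtain D where D: "prob {\<omega>\<in>space M. \<exists>w\<in>W. D < \<eta> 0 \<omega> w} \<le> \<epsilon> / 2"
    using small[OF high_start_vanishes] by blast
  define x where "x u = (if u \<in> W then D else 0)" for u
  obtain K where K: "measure_pmf.prob equilibrium {z. K < mass W z + mass W x} \<le> \<epsilon> / 2"
    using small[OF heavy_tail_vanishes] by blast
  let ?f = "\<lambda>x. of_bool (K < mass W x) :: real"
  have "prob {\<omega>\<in>space M. K < mass W (\<eta> t \<omega>)} \<le> \<epsilon>" if "0 < t" for t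
  proof -
    have cyl: "cylinder ?f" unfolding cylinder_def using mass_cong[of W] by (metis finite_greaterThanAtMost_int)
    have ev: "{\<omega>\<in>space M. K < mass W (\<eta> t \<omega>)} \<in> events"
    proof -
      have "(\<lambda>\<omega>. ?f (\<eta> t \<omega>)) \<in> borel_measurable M"
        using that by (intro measurable_compose[OF measurable cylinder_measurable[OF cyl]]) auto
      then have "(\<lambda>\<omega>. ?f (\<eta> t \<omega>)) -` {1} \<inter> space M \<in> events" by (rule measurable_sets) simp
      then show ?thesis by (simp add: vimage_def Int_def conj_commute)
    qed
    have bound: "(ring ^^ j) ?f x \<le> measure_pmf.prob equilibrium {z. K < mass W z + mass W x}" for j
      by (rule ring_iter_heavy_le) (simp add: x_def del: greaterThanAtMost_iff)
    have "expectation (\<lambda>\<omega>. ?f (\<eta> t \<omega>)) \<le> measure_pmf.prob equilibrium {z. K < mass W z + mass W x}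
        + 0 * 2 ^ 0 * exp (- (total_rate * exp (- 1) / 2 * t))
        + 1 * prob {\<omega>\<in>space M. \<exists>w\<in>W. x w < \<eta> 0 \<omega> w}"
    proof (rule expectation_le_ring_bound)
      show "mono ?f"
      proof (rule monoI)
        fix x x' :: config assume "x \<le> x'"
        then have "mass W x \<le> mass W x'" by (rule mass_mono)
        then show "?f x \<le> ?f x'" by auto
      qed
      show "?f \<eta> = ?f \<xi>" if "\<forall>x\<in>W. \<eta> x = \<xi> x" for \<eta> \<xi>
        by (simp only: mass_cong[OF that])
    qed (use that bound in auto)
    also have "{\<omega>\<in>space M. \<exists>w\<in>W. x w < \<eta> 0 \<omega> w} = {\<omega>\<in>space M. \<exists>w\<in>W. D < \<eta> 0 \<omega> w}"
      by (auto simp: x_def)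
    also have "expectation (\<lambda>\<omega>. ?f (\<eta> t \<omega>)) = expectation (indicator {\<omega>\<in>space M. K < mass W (\<eta> t \<omega>)})"
      by (intro Bochner_Integration.integral_cong) (auto simp: indicator_def)
    also have "\<dots> = prob {\<omega>\<in>space M. K < mass W (\<eta> t \<omega>)}" using ev by simp
    finally show ?thesis using K D by simp
  qed
  then show ?thesis by blast
qed

end


section \<open>The slow sites and the limiting product measure\<close>

text \<open>Among the sites left of \<open>l\<close> whose rate lies below both \<open>c + \<delta>\<close> and the rates on \<open>{l..m}\<close>, the rightmost
  one is slower than everything between it and \<open>m\<close>. Such sites exist because the lower limit at minus
  infinity is \<open>c\<close>, while the finitely many rates on \<open>{l..m}\<close> are strictly larger.\<close>
lemma slow_record_site:
  fixes p :: "int \<Rightarrow> real"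
  assumes above: "\<And>x. c < p x"
    and liminf: "Liminf at_bot (\<lambda>x. ereal (p x)) = ereal c"
    and "l \<le> m" "0 < \<delta>"
  shows "\<exists>y<l. p y < c + \<delta> \<and> (\<forall>z\<in>{y<..m}. p y < p z)"
proof -
  define a where "a = Min (insert (c + \<delta>) (p ` {l..m}))"
  have fin: "finite (insert (c + \<delta>) (p ` {l..m}))" by simp
  have "c < a" unfolding a_def using above \<open>0 < \<delta>\<close> by (subst Min_gr_iff[OF fin]) auto
  have a_le: "a \<le> c + \<delta>" "z \<in> {l..m} \<Longrightarrow> a \<le> p z" for z
    unfolding a_def by (intro Min_le fin; simp)+
  have "\<exists>y<l. p y < a"
  proof (rule ccontr)
    assume "\<not> ?thesis"
    then have "a \<le> p x" if "x \<le> l - 1" for x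
      using that by (metis not_less zle_diff1_eq)
    then have "\<forall>\<^sub>F x in at_bot. ereal a \<le> ereal (p x)"
      unfolding eventually_at_bot_linorder by (intro exI[of _ "l - 1"]) simp
    then have "ereal a \<le> Liminf at_bot (\<lambda>x. ereal (p x))" by (rule Liminf_bounded)
    then show False using liminf \<open>c < a\<close> by simp
  qed
  then obtain y\<^sub>0 where y0: "y\<^sub>0 < l" "p y\<^sub>0 < a" by blast
  define S where "S = {y \<in> {y\<^sub>0..<l}. p y < a}"
  have S: "finite S" "S \<noteq> {}"
    using y0 by (auto simp: S_def intro: finite_subset[of _ "{y\<^sub>0..<l}"])
  define y where "y = Max S"
  have "y \<in> S" unfolding y_def using S by (rule Max_in)
  then have y: "y < l" "p y < a" "y\<^sub>0 \<le> y" by (auto simp: S_def)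
  have "p y < p z" if "z \<in> {y<..m}" for z
  proof (cases "z < l")
    case True
    have "z \<notin> S" using that Max_ge[OF S(1), of z] by (auto simp: y_def)
    then have "a \<le> p z" using True that y by (auto simp: S_def)
    then show ?thesis using y by simp
  next
    case False
    then have "a \<le> p z" using that by (intro a_le) auto
    then show ?thesis using y by simp
  qed
  then show ?thesis using y a_le(1) by (intro exI[of _ y]) auto
qed

lemma expectation_Pi_pmf_local:
  assumes "finite W" "J \<subseteq> W" and local: "\<And>\<eta> \<xi>. (\<forall>x\<in>J. \<eta> x = \<xi> x) \<Longrightarrow> f \<eta> = f \<xi>"
  shows "measure_pmf.expectation (Pi_pmf W d q) f = measure_pmf.expectation (Pi_pmf J d q) (f :: _ \<Rightarrow> real)"
  unfolding Pi_pmf_subset[OF assms(1,2)]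
  by (simp, intro Bochner_Integration.integral_cong refl local) simp

text \<open>Relates the infinite product of measures to the finite product of probability mass functions in which
  the equilibrium of a tandem is expressed.\<close>
lemma restrict_nu_prod:
  assumes "finite J" "J \<noteq> {}"
  shows "distr (nu_prod p c) (\<Pi>\<^sub>M x\<in>J. count_space UNIV) (\<lambda>\<xi>. restrict \<xi> J) =
    distr (Pi_pmf J d (\<lambda>x. geometric_pmf (1 - c / p x))) (\<Pi>\<^sub>M x\<in>J. count_space UNIV) (\<lambda>\<xi>. restrict \<xi> J)"
proof -
  let ?G = "\<lambda>x. geometric_pmf (1 - c / p x)"
  let ?P = "Pi_pmf J d ?G"
  interpret product_prob_space "\<lambda>x. measure_pmf (?G x)" UNIV
    by unfold_locales
  have sets: "sets (\<Pi>\<^sub>M x\<in>J. count_space UNIV) = sets (\<Pi>\<^sub>M x\<in>J. measure_pmf (?G x))"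
    by (intro sets_PiM_cong) auto
  have "distr (nu_prod p c) (\<Pi>\<^sub>M x\<in>J. count_space UNIV) (\<lambda>\<xi>. restrict \<xi> J) =
      distr (nu_prod p c) (\<Pi>\<^sub>M x\<in>J. measure_pmf (?G x)) (\<lambda>\<xi>. restrict \<xi> J)"
    by (rule distr_cong[OF refl sets]) simp
  also have "\<dots> = (\<Pi>\<^sub>M x\<in>J. measure_pmf (?G x))"
    unfolding nu_prod_def by (rule distr_PiM_restrict_finite) (use assms in auto)
  also have "\<dots> = (\<Pi>\<^sub>M x\<in>J. distr ?P (count_space UNIV) (\<lambda>\<xi>. \<xi> x))"
    using assms by (intro PiM_cong refl) (simp add: map_pmf_rep_eq[symmetric] Pi_pmf_component)
  also have "\<dots> = distr ?P (\<Pi>\<^sub>M x\<in>J. count_space UNIV) (\<lambda>\<xi>. restrict \<xi> J)"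
    using prob_space.indep_vars_iff_distr_eq_PiM'[OF prob_space_measure_pmf[of ?P],
        where I = J and M' = "\<lambda>_. count_space UNIV" and X = "\<lambda>x \<xi>. \<xi> x"]
      indep_vars_Pi_pmf[of J d ?G] assms by simp
  finally show ?thesis .
qed

lemma expectation_nu_prod_local:
  assumes J: "finite J" "J \<noteq> {}" and local: "\<And>\<eta> \<xi>. (\<forall>x\<in>J. \<eta> x = \<xi> x) \<Longrightarrow> f \<eta> = f \<xi>"
  shows "(\<integral>\<xi>. f \<xi> \<partial>nu_prod p c) =
    measure_pmf.expectation (Pi_pmf J 0 (\<lambda>x. geometric_pmf (1 - c / p x))) (f :: config \<Rightarrow> real)"
proof -
  let ?D = "\<Pi>\<^sub>M x\<in>J. count_space (UNIV :: nat set)"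
  define g where "g r = f (\<lambda>x. if x \<in> J then r x else 0)" for r
  have f_g: "f \<xi> = g (restrict \<xi> J)" for \<xi> unfolding g_def by (rule local) simp
  have PiM: "?D = count_space (PiE J (\<lambda>_. UNIV))"
    by (rule count_space_PiM_finite) (use J in auto)
  have g: "g \<in> borel_measurable ?D" unfolding PiM by simp
  have "(\<lambda>\<xi>. restrict \<xi> J) \<in> measurable (nu_prod p c) ?D"
    unfolding nu_prod_def
    by (rule measurable_restrict) (use measurable_component_singleton[of _ UNIV "\<lambda>x. measure_pmf (geometric_pmf (1 - c / p x))"] in auto)
  then have "(\<integral>\<xi>. f \<xi> \<partial>nu_prod p c) = (\<integral>r. g r \<partial>distr (nu_prod p c) ?D (\<lambda>\<xi>. restrict \<xi> J))"
    unfolding f_g by (intro integral_distr[symmetric] g)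
  also have "\<dots> = measure_pmf.expectation (Pi_pmf J 0 (\<lambda>x. geometric_pmf (1 - c / p x))) f"
    unfolding restrict_nu_prod[OF J, of p c 0] f_g[abs_def]
    by (intro integral_distr g) (auto simp: space_PiM)
  finally show ?thesis .
qed

text \<open>Dominated convergence with respect to the counting measure. For parameters at most \<open>a\<^sub>1\<close>, which is below
  all rates on \<open>J\<close>, the probability mass functions are bounded by a constant multiple of the one with
  parameter \<open>a\<^sub>1\<close>.\<close>
lemma expectation_Pi_geometric_tendsto:
  fixes f :: "config \<Rightarrow> real"
  assumes "finite J" and c: "0 < c" and top: "\<And>x. x \<in> J \<Longrightarrow> a\<^sub>1 < p x"
    and a: "\<And>k. c \<le> a k" "\<And>k. a k \<le> a\<^sub>1" "a \<longlonglongrightarrow> c"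
    and f: "\<And>\<xi>. \<bar>f \<xi>\<bar> \<le> B"
  shows "(\<lambda>k. measure_pmf.expectation (Pi_pmf J 0 (\<lambda>x. geometric_pmf (1 - a k / p x))) f) \<longlonglongrightarrow>
    measure_pmf.expectation (Pi_pmf J 0 (\<lambda>x. geometric_pmf (1 - c / p x))) f"
proof -
  let ?P = "\<lambda>b. Pi_pmf J 0 (\<lambda>x. geometric_pmf (1 - b / p x))"
  have a1: "0 < a\<^sub>1" using c a(1)[of 0] a(2)[of 0] by linarith
  have geo: "0 \<le> 1 - b / p x" "1 - b / p x \<le> 1" "0 < 1 - b / p x" "0 \<le> b / p x" "b / p x \<le> a\<^sub>1 / p x"
    if "c \<le> b" "b \<le> a\<^sub>1" "x \<in> J" for b x
    using that c top[of x] a1 by (auto simp: field_simps)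
  have pmf_eq: "pmf (?P b) \<xi> = (if \<forall>x. x \<notin> J \<longrightarrow> \<xi> x = 0 then \<Prod>x\<in>J. (b / p x) ^ \<xi> x * (1 - b / p x) else 0)"
    if "c \<le> b" "b \<le> a\<^sub>1" for b \<xi>
    using geo[OF that] \<open>finite J\<close> by (auto simp: pmf_Pi intro!: prod.cong)
  have expand: "measure_pmf.expectation q f = (\<integral>\<xi>. pmf q \<xi> * f \<xi> \<partial>count_space UNIV)" for q :: "config pmf"
    unfolding measure_pmf_eq_density by (subst integral_density) auto
  let ?K = "\<Prod>x\<in>J. 1 / (1 - a\<^sub>1 / p x)"
  have B: "0 \<le> B" using f[of undefined] by linarith
  have bound: "pmf (?P b) \<xi> \<le> ?K * pmf (?P a\<^sub>1) \<xi>" if b: "c \<le> b" "b \<le> a\<^sub>1" for b \<xi>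
  proof (cases "\<forall>x. x \<notin> J \<longrightarrow> \<xi> x = 0")
    case True
    have c1: "c \<le> a\<^sub>1" using b by simp
    have "(\<Prod>x\<in>J. (b / p x) ^ \<xi> x * (1 - b / p x)) \<le>
        (\<Prod>x\<in>J. 1 / (1 - a\<^sub>1 / p x) * ((a\<^sub>1 / p x) ^ \<xi> x * (1 - a\<^sub>1 / p x)))"
    proof (rule prod_mono)
      fix x assume x: "x \<in> J"
      note g = geo[OF b x] and g1 = geo[OF c1 order.refl x]
      have "(b / p x) ^ \<xi> x * (1 - b / p x) \<le> (a\<^sub>1 / p x) ^ \<xi> x * 1"
        using g g1 by (intro mult_mono power_mono) auto
      also have "\<dots> = 1 / (1 - a\<^sub>1 / p x) * ((a\<^sub>1 / p x) ^ \<xi> x * (1 - a\<^sub>1 / p x))"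
      proof -
        have "A * 1 = 1 / d * (A * d)" if "0 < d" for A d :: real using that by simp
        then show ?thesis using g1(3) .
      qed
      finally show "0 \<le> (b / p x) ^ \<xi> x * (1 - b / p x) \<and> (b / p x) ^ \<xi> x * (1 - b / p x) \<le>
          1 / (1 - a\<^sub>1 / p x) * ((a\<^sub>1 / p x) ^ \<xi> x * (1 - a\<^sub>1 / p x))"
        using g by simp
    qed
    then show ?thesis unfolding pmf_eq[OF b] pmf_eq[OF c1 order.refl] if_P[OF True] prod.distrib .
  next
    case False
    have c1: "c \<le> a\<^sub>1" using b by simp
    show ?thesis unfolding pmf_eq[OF b] pmf_eq[OF c1 order.refl] if_not_P[OF False] by simp
  qed
  show ?thesis
    unfolding expand
  proof (rule integral_dominated_convergence[where w = "\<lambda>\<xi>. ?K * pmf (?P a\<^sub>1) \<xi> * B"])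
    show "integrable (count_space UNIV) (\<lambda>\<xi>. ?K * pmf (?P a\<^sub>1) \<xi> * B)"
      by (intro integrable_mult_left integrable_mult_right integrable_pmf)
    show "AE \<xi> in count_space UNIV. norm (pmf (?P (a k)) \<xi> * f \<xi>) \<le> ?K * pmf (?P a\<^sub>1) \<xi> * B" for k
    proof (rule AE_I2)
      fix \<xi>
      have "norm (pmf (?P (a k)) \<xi> * f \<xi>) = pmf (?P (a k)) \<xi> * \<bar>f \<xi>\<bar>" by (simp add: abs_mult)
      also have "\<dots> \<le> ?K * pmf (?P a\<^sub>1) \<xi> * B"
        using bound[OF a(1) a(2), of k \<xi>] f[of \<xi>] order_trans[OF pmf_nonneg bound[OF a(1) a(2), of k \<xi>]]
        by (intro mult_mono) auto
      finally show "norm (pmf (?P (a k)) \<xi> * f \<xi>) \<le> ?K * pmf (?P a\<^sub>1) \<xi> * B" .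
    qed
    have "(\<lambda>k. pmf (?P (a k)) \<xi>) \<longlonglongrightarrow> pmf (?P c) \<xi>" for \<xi>
    proof -
      have c1: "c \<le> a\<^sub>1" using a(1)[of 0] a(2)[of 0] by linarith
      have "p x \<noteq> 0" if "x \<in> J" for x using top[OF that] a1 by simp
      then have "(\<lambda>k. \<Prod>x\<in>J. (a k / p x) ^ \<xi> x * (1 - a k / p x)) \<longlonglongrightarrow> (\<Prod>x\<in>J. (c / p x) ^ \<xi> x * (1 - c / p x))"
        by (intro tendsto_intros a(3))
      then have *: "(\<lambda>k. if C then \<Prod>x\<in>J. (a k / p x) ^ \<xi> x * (1 - a k / p x) else 0) \<longlonglongrightarrow>
          (if C then \<Prod>x\<in>J. (c / p x) ^ \<xi> x * (1 - c / p x) else 0)" for C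
        by (cases C) simp_all
      show ?thesis
        unfolding pmf_eq[OF a(1,2)] pmf_eq[OF order.refl c1] by (rule *)
    qed
    then show "AE \<xi> in count_space UNIV. (\<lambda>k. pmf (?P (a k)) \<xi> * f \<xi>) \<longlonglongrightarrow> pmf (?P c) \<xi> * f \<xi>"
      by (intro AE_I2 tendsto_intros)
  qed auto
qed


section \<open>Tightness and weak limits\<close>

lemma compact_box: "compact {\<xi>::config. \<forall>w. \<xi> w \<le> k w}"
proof -
  have "{\<xi>::config. \<forall>w. \<xi> w \<le> k w} = PiE UNIV (\<lambda>w. {..k w})" by auto
  moreover have "compactin (product_topology (\<lambda>_. euclidean) UNIV) (PiE UNIV (\<lambda>w. {..k w :: nat}))"
    by (subst compactin_PiE) (auto intro: finite_imp_compact)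
  ultimately show ?thesis by (simp add: euclidean_product_topology)
qed

text \<open>By Tychonoff's theorem a compact set is obtained by bounding the number of particles at every site.
  The bound at site \<open>w\<close> comes from the tandem of queues that ends at \<open>w\<close>; a union bound over the sites, with
  geometric weights, completes the argument.\<close>
lemma zero_range_tight:
  assumes zr: "zero_range_process M p N \<eta>"
    and c: "0 < c" "\<And>x. c < p x" "Liminf at_bot (\<lambda>x. ereal (p x)) = ereal c"
  shows "tight_family {distr M borel (\<eta> t) | t. t > 0}"
  unfolding tight_family_def
proof (intro allI impI)
  fix \<epsilon> :: real assume "0 < \<epsilon>"
  interpret zero_range_process M p N \<eta> by (rule zr)
  have event: "{\<omega>\<in>space M. \<eta> t \<omega> \<in> U} \<in> events" if "0 < t" "open U" for t U
    using measurable_sets[OF measurable, of t U] that by (simp add: vimage_def Int_def conj_commute)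
  have site: "\<exists>k. \<forall>t>0. prob {\<omega>\<in>space M. k < \<eta> t \<omega> w} \<le> \<delta>" if "0 < \<delta>" for w and \<delta> :: real
  proof -
    obtain y where y: "y < w" "\<forall>z\<in>{y<..w}. p y < p z"
      using slow_record_site[OF c(2,3), of w w 1] by auto
    interpret queue_window M p N \<eta> y w
      by unfold_locales (use y c(1) less_trans[OF c(1) c(2)] in auto)
    obtain k where k: "\<And>t. 0 < t \<Longrightarrow> prob {\<omega>\<in>space M. k < mass {y<..w} (\<eta> t \<omega>)} \<le> \<delta>"
      using uniform_mass_tail[OF \<open>0 < \<delta>\<close>] by blast
    have "prob {\<omega>\<in>space M. k < \<eta> t \<omega> w} \<le> \<delta>" if "0 < t" for t
    proof -
      have "\<eta> t \<omega> w \<le> mass {y<..w} (\<eta> t \<omega>)" for \<omega>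
        unfolding mass_def using y(1) by (intro member_le_sum) auto
      then have "{\<omega>\<in>space M. k < \<eta> t \<omega> w} \<subseteq> {\<omega>\<in>space M. k < mass {y<..w} (\<eta> t \<omega>)}"
        by (auto intro: less_le_trans)
      moreover have "{\<omega>\<in>space M. k < mass {y<..w} (\<eta> t \<omega>)} \<in> events"
      proof -
        have "cylinder (\<lambda>x. of_bool (k < mass {y<..w} x) :: real)"
          unfolding cylinder_def using mass_cong[of "{y<..w}"] by (metis finite_greaterThanAtMost_int)
        then have "open ((\<lambda>x. of_bool (k < mass {y<..w} x) :: real) -` {0<..})"
          by (intro open_vimage cylinder_continuous) auto
        from event[OF that this] show ?thesis by simp
      qed
      ultimately have "prob {\<omega>\<in>space M. k < \<eta> t \<omega> w} \<le> prob {\<omega>\<in>space M. k < mass {y<..w} (\<eta> t \<omega>)}"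
        by (rule finite_measure_mono)
      then show ?thesis using k[OF that] by simp
    qed
    then show ?thesis by blast
  qed
  have "\<forall>w. \<exists>k. \<forall>t>0. prob {\<omega>\<in>space M. k < \<eta> t \<omega> w} \<le> \<epsilon> / 4 * (1 / 2) ^ to_nat w"
    by (intro allI site) (use \<open>0 < \<epsilon>\<close> in simp)
  then obtain k where k: "\<And>w t. 0 < t \<Longrightarrow> prob {\<omega>\<in>space M. k w < \<eta> t \<omega> w} \<le> \<epsilon> / 4 * (1 / 2) ^ to_nat w"
    by metis
  show "\<exists>K. compact K \<and> (\<forall>\<mu>\<in>{distr M borel (\<eta> t) |t. 0 < t}. measure \<mu> (space \<mu> - K) < \<epsilon>)"
  proof (intro exI[of _ "{\<xi>. \<forall>w. \<xi> w \<le> k w}"] conjI ballI)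
    show "compact {\<xi>. \<forall>w. \<xi> w \<le> k w}" by (rule compact_box)
    fix \<mu> assume "\<mu> \<in> {distr M borel (\<eta> t) |t. 0 < t}"
    then obtain t where t: "0 < t" and \<mu>: "\<mu> = distr M borel (\<eta> t)" by blast
    let ?U = "{\<xi>::config. \<exists>w\<in>UNIV. k w < \<xi> w}"
    define A where "A w = {\<omega>\<in>space M. k w < \<eta> t \<omega> w}" for w
    have A: "A w \<in> events" for w
      using event[OF t, of "{\<xi>. \<exists>u\<in>{w}. k u < \<xi> u}"] open_some_site_exceeds[of "{w}" k] by (simp add: A_def)
    \<comment> \<open>The union over sites as a union over naturals; numbers that encode no site contribute nothing.\<close>
    define A' where "A' n = (if n \<in> range (to_nat :: int \<Rightarrow> nat) then A (from_nat n) else {})" for n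
    have le: "prob (A' n) \<le> \<epsilon> / 4 * (1 / 2) ^ n" for n
      using k[OF t] \<open>0 < \<epsilon>\<close> by (auto simp: A'_def A_def)
    have sums: "(\<lambda>n. \<epsilon> / 4 * (1 / 2) ^ n) sums (\<epsilon> / 4 * 2)"
      using geometric_sums[of "1 / 2 :: real"] by (intro sums_mult) simp
    have summable: "summable (\<lambda>n. prob (A' n))"
      by (rule summable_comparison_test[OF _ sums_summable[OF sums]]) (use le in auto)
    have "measure \<mu> (space \<mu> - {\<xi>. \<forall>w. \<xi> w \<le> k w}) = measure \<mu> ?U"
      by (rule arg_cong[where f = "measure \<mu>"]) (simp add: \<mu> set_eq_iff not_le)
    also have "\<dots> = prob (\<eta> t -` ?U \<inter> space M)"
      unfolding \<mu> using t by (intro measure_distr measurable) (auto intro!: borel_open open_some_site_exceeds)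
    also have "\<eta> t -` ?U \<inter> space M = (\<Union>n. A' n)"
    proof -
      have "(\<Union>n. A' n) = (\<Union>w. A w)" unfolding A'_def by (auto split: if_splits)
      then show ?thesis by (auto simp: A_def)
    qed
    also have "prob \<dots> \<le> (\<Sum>n. prob (A' n))"
      using A summable by (intro finite_measure_subadditive_countably) (auto simp: A'_def)
    also have "\<dots> \<le> (\<Sum>n. \<epsilon> / 4 * (1 / 2) ^ n)"
      by (intro suminf_le le summable sums_summable[OF sums])
    also have "\<dots> < \<epsilon>" using sums_unique[OF sums] \<open>0 < \<epsilon>\<close> by simp
    finally show "measure \<mu> (space \<mu> - {\<xi>. \<forall>w. \<xi> w \<le> k w}) < \<epsilon>" .
  qed
qed

text \<open>An increasing cylinder function is bounded in the limit by its expectation in the equilibrium of every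
  tandem whose window contains the relevant sites. The sources \<open>y k\<close> of these tandems are chosen such
  that their rates tend to \<open>c\<close>. Adding a constant makes the function nonnegative.\<close>
lemma zero_range_weak_limit_le:
  assumes zr: "zero_range_process M p N \<eta>"
    and c: "0 < c" "\<And>x. c < p x" "Liminf at_bot (\<lambda>x. ereal (p x)) = ereal c"
    and T: "filterlim T at_top sequentially"
    and \<nu>': "prob_space \<nu>'" "sets \<nu>' = sets borel"
    and weak: "weakly_converges (\<lambda>n. distr M borel (\<eta> (T n))) \<nu>'"
  shows "stoch_le \<nu>' (nu_prod p c)"
  unfolding stoch_le_def
proof (intro allI impI)
  fix f :: "config \<Rightarrow> real" assume "bounded (range f)" and mono: "mono f" and cyl: "cylinder f"
  interpret zero_range_process M p N \<eta> by (rule zr)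
  interpret \<nu>': prob_space \<nu>' by (rule \<nu>'(1))
  interpret nu: product_prob_space "\<lambda>x. measure_pmf (geometric_pmf (1 - c / p x))" UNIV by unfold_locales
  interpret nu: prob_space "nu_prod p c" unfolding nu_prod_def by (rule nu.prob_space_axioms)
  obtain B where B: "\<And>x. \<bar>f x\<bar> \<le> B"
    using \<open>bounded (range f)\<close> by (auto simp: bounded_iff)
  define g where "g x = f x + B" for x
  have g: "mono g" "\<And>x. 0 \<le> g x" "\<And>x. g x \<le> 2 * B"
    using B mono by (auto simp: g_def mono_def abs_le_iff) (smt (verit) B)+
  obtain J\<^sub>0 where J0: "finite J\<^sub>0" "\<And>\<eta> \<xi>. (\<forall>x\<in>J\<^sub>0. \<eta> x = \<xi> x) \<Longrightarrow> f \<eta> = f \<xi>"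
    using cyl unfolding cylinder_def by blast
  define J where "J = insert 0 J\<^sub>0"
  have J: "finite J" "J \<noteq> {}" using J0 by (auto simp: J_def)
  have local: "g \<eta> = g \<xi>" if "\<forall>x\<in>J. \<eta> x = \<xi> x" for \<eta> \<xi>
    using J0(2)[of \<eta> \<xi>] that by (simp add: g_def J_def)
  have cyl_g: "cylinder g" unfolding cylinder_def using local J(1) by blast
  have lim: "(\<lambda>n. expectation (\<lambda>\<omega>. g (\<eta> (T n) \<omega>))) \<longlonglongrightarrow> (\<integral>\<xi>. g \<xi> \<partial>\<nu>')"
  proof -
    have "bounded (range g)" unfolding bounded_iff using g(2,3) by (intro exI[of _ "2 * B"]) auto
    then have "(\<lambda>n. \<integral>\<xi>. g \<xi> \<partial>distr M borel (\<eta> (T n))) \<longlonglongrightarrow> (\<integral>\<xi>. g \<xi> \<partial>\<nu>')"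
      using weak cylinder_continuous[OF cyl_g] unfolding weakly_converges_def by blast
    moreover have "\<forall>\<^sub>F n in sequentially. (\<integral>\<xi>. g \<xi> \<partial>distr M borel (\<eta> (T n))) = expectation (\<lambda>\<omega>. g (\<eta> (T n) \<omega>))"
      using filterlim_at_top_dense[THEN iffD1, OF T, rule_format, of 0]
      by eventually_elim (intro integral_distr measurable cylinder_measurable[OF cyl_g], simp)
    ultimately show ?thesis by (rule Lim_transform_eventually)
  qed
  let ?l = "Min J" and ?m = "Max J"
  let ?P = "\<lambda>b. Pi_pmf J 0 (\<lambda>x. geometric_pmf (1 - b / p x))"
  have lm: "?l \<le> ?m" using J by simp
  \<comment> \<open>Any number strictly between \<open>c\<close> and the rates on \<open>J\<close> would do; it dominates the rates of the sources.\<close>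
  define a\<^sub>1 where "a\<^sub>1 = (c + Min (p ` J)) / 2"
  have "c < Min (p ` J)" using J c(2) by (subst Min_gr_iff) auto
  then have a1: "c < a\<^sub>1" by (simp add: a\<^sub>1_def)
  have a1_less: "a\<^sub>1 < p x" if "x \<in> J" for x
  proof -
    have "Min (p ` J) \<le> p x" using J that by simp
    then show ?thesis using c(2)[of x] by (simp add: a\<^sub>1_def)
  qed
  have "\<exists>y<?l. p y < c + min (a\<^sub>1 - c) (inverse (real (Suc k))) \<and> (\<forall>z\<in>{y<..?m}. p y < p z)" for k
    by (rule slow_record_site[OF c(2,3) lm]) (use a1 in auto)
  then obtain y where y: "\<And>k. y k < ?l" "\<And>k. p (y k) < c + min (a\<^sub>1 - c) (inverse (real (Suc k)))"
    "\<And>k z. z \<in> {y k<..?m} \<Longrightarrow> p (y k) < p z" by metis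
  have le_k: "(\<integral>\<xi>. g \<xi> \<partial>\<nu>') \<le> measure_pmf.expectation (?P (p (y k))) g" for k
  proof -
    interpret queue_window M p N \<eta> "y k" ?m
      by unfold_locales (use y lm c(1) less_trans[OF c(1) c(2)] in \<open>auto intro: less_le_trans\<close>)
    have sub: "J \<subseteq> {y k<..?m}"
      using J y(1)[of k] by (auto intro: less_le_trans)
    have local_W: "g \<eta> = g \<xi>" if "\<forall>x\<in>{y k<..?m}. \<eta> x = \<xi> x" for \<eta> \<xi>
      using that sub by (intro local) blast
    have "(\<integral>\<xi>. g \<xi> \<partial>\<nu>') \<le> measure_pmf.expectation equilibrium g + \<epsilon>" if "0 < \<epsilon>" for \<epsilon>
    proof (rule tendsto_upperbound[OF lim])
      show "\<forall>\<^sub>F n in sequentially. expectation (\<lambda>\<omega>. g (\<eta> (T n) \<omega>)) \<le> measure_pmf.expectation equilibrium g + \<epsilon>"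
        using eventually_expectation_le_equilibrium[OF g local_W that] T by (rule eventually_compose_filterlim)
    qed simp
    then have "(\<integral>\<xi>. g \<xi> \<partial>\<nu>') \<le> measure_pmf.expectation equilibrium g" by (rule field_le_epsilon)
    also have "\<dots> = measure_pmf.expectation (?P (p (y k))) g"
      unfolding equilibrium_def by (rule expectation_Pi_pmf_local[OF _ sub local]) auto
    finally show ?thesis .
  qed
  have "(\<lambda>k. p (y k)) \<longlonglongrightarrow> c"
  proof (rule tendsto_sandwich[OF _ _ tendsto_const])
    show "(\<lambda>k. c + inverse (real (Suc k))) \<longlonglongrightarrow> c"
      using tendsto_add[OF tendsto_const LIMSEQ_inverse_real_of_nat, of c] by simp
    show "\<forall>\<^sub>F k in sequentially. c \<le> p (y k)" using c(2) by (simp add: less_imp_le)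
    show "\<forall>\<^sub>F k in sequentially. p (y k) \<le> c + inverse (real (Suc k))"
      using y(2) by (intro always_eventually allI) (smt (verit))
  qed
  then have "(\<lambda>k. measure_pmf.expectation (?P (p (y k))) g) \<longlonglongrightarrow> measure_pmf.expectation (?P c) g"
  proof (rule expectation_Pi_geometric_tendsto[OF J(1) c(1) a1_less, rotated 3])
    show "p (y k) \<le> a\<^sub>1" for k using y(2)[of k] by linarith
    show "\<bar>g \<xi>\<bar> \<le> 2 * B" for \<xi> using g(2,3)[of \<xi>] by simp
  qed (use c(2) in \<open>auto intro: less_imp_le\<close>)
  then have "(\<integral>\<xi>. g \<xi> \<partial>\<nu>') \<le> measure_pmf.expectation (?P c) g"
    by (rule LIMSEQ_le_const) (use le_k in blast)
  also have "\<dots> = (\<integral>\<xi>. g \<xi> \<partial>nu_prod p c)"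
    by (rule expectation_nu_prod_local[OF J local, symmetric])
  finally have le: "(\<integral>\<xi>. g \<xi> \<partial>\<nu>') \<le> (\<integral>\<xi>. g \<xi> \<partial>nu_prod p c)" .
  have "(\<integral>\<xi>. g \<xi> \<partial>\<mu>) = (\<integral>\<xi>. f \<xi> \<partial>\<mu>) + B" if "prob_space \<mu>" "sets \<mu> = sets borel" for \<mu>
  proof -
    interpret \<mu>: prob_space \<mu> by fact
    have "f \<in> borel_measurable \<mu>"
      using cylinder_measurable[OF cyl] by (simp add: measurable_cong_sets[OF that(2) refl])
    then have "integrable \<mu> f" by (intro \<mu>.integrable_const_bound[where B = B]) (use B in auto)
    then show ?thesis by (simp add: g_def[abs_def] \<mu>.prob_space)
  qed
  from this[OF \<nu>'] this[OF nu.prob_space_axioms sets_nu_prod] le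
  show "(\<integral>\<xi>. f \<xi> \<partial>\<nu>') \<le> (\<integral>\<xi>. f \<xi> \<partial>nu_prod p c)" by simp
qed

theorem proposition2p2:
  fixes p :: "int \<Rightarrow> real" and c :: real
    and \<nu> :: "config measure"
    and M :: "'a measure"
    and N :: "int \<Rightarrow> real \<Rightarrow> 'a \<Rightarrow> nat"
    and \<eta> :: "real \<Rightarrow> 'a \<Rightarrow> config"
  assumes "environment p c"
    and "\<forall>x. p x > c"
    and "Liminf at_bot (\<lambda>x. ereal (p x)) = ereal c"
    and "prob_space \<nu>" and "sets \<nu> = sets borel"
    and "zero_range_process M p N \<eta>"
    and "distr M borel (\<eta> 0) = \<nu>"
  shows "tight_family {distr M borel (\<eta> t) | t. t > 0} \<and>
    (\<forall>T \<nu>'. (\<forall>n. T n > 0) \<longrightarrow> filterlim T at_top sequentially \<longrightarrow>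
       prob_space \<nu>' \<longrightarrow> sets \<nu>' = sets borel \<longrightarrow>
       weakly_converges (\<lambda>n. distr M borel (\<eta> (T n))) \<nu>' \<longrightarrow>
       stoch_le \<nu>' (nu_prod p c))"
proof -
  have c: "0 < c" "\<And>x. c < p x" using assms(1,2) by (auto simp: environment_def)
  show ?thesis
    using zero_range_tight[OF assms(6) c assms(3)] zero_range_weak_limit_le[OF assms(6) c assms(3)]
    by blast
qed

end
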